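(* Let $\gamma>0$ and let $\mathbb{S}$ be the circle of unit length. Let $u_0\in H^3(\mathbb{S})$ with $\int_{\mathbb{S}}u_0(x)\,dx=0$, and suppose that the solution $u(t,x)$ of the Cauchy problem $u_t+uu_x=\gamma\partial_x^{-1}u$, $x\in\mathbb{S}$, $t>0$, $u(0,x)=u_0(x)$, has finite blow-up time $T\in(0,\infty)$. Then $$\lim_{t\uparrow T}\left((T-t)\inf_{x\in\mathbb{S}}u_x(t,x)\right)=-1\quad\text{and}\quad\lim_{t\uparrow T}\left((T-t)\sup_{x\in\mathbb{S}}u_x(t,x)\right)=0.$$
   Context: All functions are real-valued. For zero-mean $u$ on $\mathbb{S}$, $\partial_x^{-1}u$ is the mean-zero anti-derivative $\partial_x^{-1}u(t,x)=\int_0^xu(t,x')\,dx'-\int_{\mathbb{S}}\int_0^xu(t,x')\,dx'\,dx$; the Cauchy problem is equivalent to $(u_t+uu_x)_x=\gamma u$, $u(0,x)=u_0(x)$. "The solution" is the unique solution $u\in C([0,T);H^3(\mathbb{S}))\cap C^1([0,T);H^2(\mathbb{S}))$ on its maximal existence interval $[0,T)$; it exists for every zero-mean $u_0\in H^3(\mathbb{S})$, has zero mean and conserved $L^2$-norm. The maximal time is the same in every $H^s$, $s\ge2$, to which the data belongs. "Finite blow-up time $T$" means the maximal time $T$ is finite, with $\lim_{t\uparrow T}\|u(t,\cdot)\|_{H^s}=\infty$, equivalently $\lim_{t\uparrow T}\inf_{x\in\mathbb{S}}u_x(t,x)=-\infty$. *)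

theory Defs
  imports "HOL-Analysis.Analysis"
begin

text \<open>
  Functions on the circle of unit length are 1-periodic functions on the real line;
  \<open>{0..1}\<close> serves as a fundamental domain.
\<close>

definition fourier_coeff :: "(real \<Rightarrow> real) \<Rightarrow> int \<Rightarrow> complex" where
  "fourier_coeff f k =
     integral {0..1} (\<lambda>x. complex_of_real (f x) * cis (- (2 * pi * of_int k * x)))"

text \<open>
  Membership in \<open>H\<^sup>s\<close> is expressed through the continuous representative, which exists and is
  unique for \<open>s \<ge> 1\<close>; the definitions below are used for \<open>s = 2\<close> and \<open>s = 3\<close> only.
\<close>

definition sobolev :: "nat \<Rightarrow> (real \<Rightarrow> real) set" where
  "sobolev s = {f. (\<forall>x. f (x + 1) = f x) \<and> continuous_on UNIV f \<and>
     (\<lambda>k::int. (1 + (2 * pi * of_int k)\<^sup>2) ^ s * (cmod (fourier_coeff f k))\<^sup>2) summable_on UNIV}"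

definition sobolev_norm :: "nat \<Rightarrow> (real \<Rightarrow> real) \<Rightarrow> real" where
  "sobolev_norm s f =
     sqrt (\<Sum>\<^sub>\<infinity>k::int. (1 + (2 * pi * of_int k)\<^sup>2) ^ s * (cmod (fourier_coeff f k))\<^sup>2)"

definition sobolev_continuous :: "nat \<Rightarrow> real set \<Rightarrow> (real \<Rightarrow> real \<Rightarrow> real) \<Rightarrow> bool" where
  "sobolev_continuous s I u \<longleftrightarrow>
     (\<forall>t\<in>I. u t \<in> sobolev s) \<and>
     (\<forall>t\<in>I. ((\<lambda>r. sobolev_norm s (\<lambda>x. u r x - u t x)) \<longlongrightarrow> 0) (at t within I))"

text \<open>
  The norm is only meaningful on \<open>sobolev s\<close>, so membership of \<open>u t\<close> and \<open>v t\<close> is required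
  explicitly. At an end point belonging to \<open>I\<close> the derivative is one-sided.
\<close>

definition sobolev_has_derivative ::
    "nat \<Rightarrow> real set \<Rightarrow> (real \<Rightarrow> real \<Rightarrow> real) \<Rightarrow> (real \<Rightarrow> real \<Rightarrow> real) \<Rightarrow> bool" where
  "sobolev_has_derivative s I u v \<longleftrightarrow>
     (\<forall>t\<in>I. u t \<in> sobolev s \<and> v t \<in> sobolev s) \<and>
     (\<forall>t\<in>I. ((\<lambda>r. sobolev_norm s (\<lambda>x. (u r x - u t x) / (r - t) - v t x)) \<longlongrightarrow> 0)
        (at t within I))"

text \<open>The mean-zero antiderivative, evaluated at points \<open>x\<close> of the fundamental domain \<open>{0..1}\<close>.\<close>

definition antideriv :: "(real \<Rightarrow> real) \<Rightarrow> real \<Rightarrow> real" where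
  "antideriv f x = integral {0..x} f - integral {0..1} (\<lambda>z. integral {0..z} f)"

text \<open>
  \<open>u \<in> C([0,T);H\<^sup>3) \<inter> C\<^sup>1([0,T);H\<^sup>2)\<close> solves the Cauchy problem; \<open>v\<close> is the \<open>H\<^sup>2\<close>-valued time
  derivative. The equation is imposed at both \<open>x = 0\<close> and \<open>x = 1\<close>, so that periodicity of
  \<open>u t\<close> and \<open>v t\<close> forces \<open>u t\<close> to have zero mean for \<open>0 < t < T\<close>.
\<close>

definition ostrovsky_hunter_solution ::
    "real \<Rightarrow> (real \<Rightarrow> real) \<Rightarrow> real \<Rightarrow> (real \<Rightarrow> real \<Rightarrow> real) \<Rightarrow> bool" where
  "ostrovsky_hunter_solution \<gamma> u0 T u \<longleftrightarrow>
     u 0 = u0 \<and>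
     sobolev_continuous 3 {0..<T} u \<and>
     (\<exists>v. sobolev_continuous 2 {0..<T} v \<and>
          sobolev_has_derivative 2 {0..<T} u v \<and>
          (\<forall>t\<in>{0<..<T}. \<forall>x\<in>{0..1}.
             v t x + u t x * deriv (u t) x = \<gamma> * antideriv (u t) x))"

definition maximal_solution ::
    "real \<Rightarrow> (real \<Rightarrow> real) \<Rightarrow> real \<Rightarrow> (real \<Rightarrow> real \<Rightarrow> real) \<Rightarrow> bool" where
  "maximal_solution \<gamma> u0 T u \<longleftrightarrow>
     ostrovsky_hunter_solution \<gamma> u0 T u \<and>
     \<not> (\<exists>T'>T. \<exists>w. ostrovsky_hunter_solution \<gamma> u0 T' w \<and> (\<forall>t\<in>{0..<T}. w t = u t))"

definition finite_blow_up_time ::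
    "real \<Rightarrow> (real \<Rightarrow> real) \<Rightarrow> real \<Rightarrow> (real \<Rightarrow> real \<Rightarrow> real) \<Rightarrow> bool" where
  "finite_blow_up_time \<gamma> u0 T u \<longleftrightarrow>
     0 < T \<and> maximal_solution \<gamma> u0 T u \<and>
     filterlim (\<lambda>t. sobolev_norm 3 (u t)) at_top (at_left T)"

end

theory Submission
  imports Defs
begin

text \<open>
  Write \<open>w = u\<^sub>x\<close>, so that \<open>w\<^sub>t + u w\<^sub>x = - w\<^sup>2 + \<gamma> u\<close>. A maximum principle bounds \<open>u\<close> on \<open>[T/2, T)\<close>
  (the antiderivative is dominated by \<open>sup \<bar>u\<bar>\<close>), and then bounds \<open>w\<close> from above, which settles the
  supremum. For the infimum, \<open>w\<close> is compared with \<open>- c / (\<tau> - t)\<close>, a strict subsolution or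
  supersolution of the Riccati equation near \<open>\<tau>\<close> according as \<open>c < 1\<close> or \<open>c > 1\<close>.
  With \<open>c > 1\<close> and \<open>\<tau> < T\<close> the comparison runs backwards in time from near \<open>\<tau>\<close>, where
  \<open>w\<close> is bounded, and yields the lower bound. With \<open>c < 1\<close> and \<open>\<tau> > T\<close>, an infimum lying above
  the barrier would keep \<open>w\<close> bounded up to time \<open>T\<close>; but then the \<open>H\<^sup>3\<close> norm stays bounded, by the
  usual energy estimate. Since \<open>u\<^sub>t\<close> is only in \<open>H\<^sup>2\<close>, that estimate is carried out for
  the third differences of \<open>u\<close>, all of whose manipulations are classical.
\<close>

section \<open>Periodic functions\<close>

text \<open>The spaces are given by Fourier coefficients alone, so pointwise arguments can start
  only after coefficients have been turned into functions: completeness of the characters,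
  inversion, Parseval and termwise differentiation are established for absolutely summable
  coefficients, which membership in H^1 guarantees. At a first touching point of solution and
  barrier the transport term vanishes, but a contradiction needs a strict sign of the time
  derivative. Hence all barriers carry slack: rate 2 \<gamma> in the exponential bound for u, and c
  = 1 + \<delta> or 1 - \<delta> in the blow-up rates. The latter are proved at each single t close
  to T, with \<tau> at distance \<delta> (T - t) from T, so that (T - t) times the barrier at t is a
  ratio of 1 + \<delta> and 1 - \<delta>; \<delta> is tied to the tolerance only at the very end. In
  the energy estimate a third difference of step h costs h^6 in the squared L^2 norm. Each remainder
  must therefore be bounded by h^6 times the squared H^3 norm with constants free of h; dividing by
  h^6 and letting h tend to 0 then recovers the H^3 norm.\<close>

definition periodic :: "(real \<Rightarrow> 'a) \<Rightarrow> bool" where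
  "periodic f \<longleftrightarrow> (\<forall>x. f (x + 1) = f x)"

lemma periodic_int:
  assumes "periodic f"
  shows "f (x + of_int k) = f x"
proof (induction k rule: int_induct[where k = 0])
  case (step1 i)
  then show ?case
    using assms[unfolded periodic_def, rule_format, of "x + of_int i"] by (simp add: add.assoc)
next
  case (step2 i)
  have "f (x + of_int (i - 1) + 1) = f (x + of_int (i - 1))"
    using assms unfolding periodic_def by blast
  then show ?case using step2 by simp
qed simp

lemma periodic_frac:
  assumes "periodic f"
  shows "f (frac x) = f x"
  using periodic_int[OF assms, of x "- \<lfloor>x\<rfloor>"] by (simp add: frac_def)

lemma periodic_shift:
  assumes "periodic f"
  shows "periodic (\<lambda>x. f (x + a))"
  unfolding periodic_def
proof
  fix x
  show "f (x + 1 + a) = f (x + a)"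
    using periodic_int[OF assms, of "x + a" 1] by (simp add: algebra_simps)
qed

lemma continuous_antiderivative:
  fixes f :: "real \<Rightarrow> 'a::euclidean_space"
  assumes "continuous_on UNIV f"
  obtains G where "\<And>x. (G has_vector_derivative f x) (at x)"
  using einterval_antiderivative[of "-\<infinity>" "\<infinity>" f] assms
  by (auto simp: continuous_on_eq_continuous_at)

lemma integral_01_derivative:
  fixes H :: "real \<Rightarrow> 'a::banach"
  assumes "\<And>x. (H has_vector_derivative h x) (at x)"
  shows "(h has_integral (H 1 - H 0)) {0..1}"
  using assms by (intro fundamental_theorem_of_calculus) (auto intro: has_vector_derivative_at_within)

text \<open>The increment over one period has derivative f (x + 1) - f x = 0. Besides shift
  invariance of integrals, this gives the criterion used later: an antiderivative is periodic
  exactly when the mean of f vanishes.\<close>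

lemma antiderivative_increment:
  fixes G :: "real \<Rightarrow> 'a::euclidean_space"
  assumes G: "\<And>x. (G has_vector_derivative f x) (at x)" and f: "periodic f"
  shows "G (x + 1) - G x = integral {0..1} f"
proof -
  have "((\<lambda>x. G (x + 1) - G x) has_vector_derivative 0) (at x)" for x
  proof -
    have "((\<lambda>x. G (x + 1)) has_vector_derivative f (x + 1)) (at x)"
      using vector_diff_chain_at[of "\<lambda>x. x + 1" 1 x G "f (x + 1)"] G[of "x + 1"]
      by (simp add: o_def has_vector_derivative_add_const)
    from has_vector_derivative_diff[OF this G[of x]] show ?thesis
      using f by (simp add: periodic_def)
  qed
  then obtain c0 where "\<And>x. x \<in> UNIV \<Longrightarrow> G (x + 1) - G x = c0"
    by (rule has_vector_derivative_zero_constant[OF convex_UNIV]) blast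
  from this[OF UNIV_I] have "G (x + 1) - G x = G 1 - G 0"
    using \<open>G (0 + 1) - G 0 = c0\<close> by simp
  then show ?thesis using integral_01_derivative[OF G] by (simp add: integral_unique)
qed

text \<open>With an antiderivative G on the whole line, both integrals become increments of G over
  an interval of length one.\<close>

lemma
  fixes f :: "real \<Rightarrow> 'a::euclidean_space"
  assumes f: "continuous_on UNIV f" "periodic f"
  shows integral_periodic_shift: "integral {0..1} (\<lambda>x. f (x + a)) = integral {0..1} f"
    and integral_periodic_reflect: "integral {0..1} (\<lambda>x. f (a - x)) = integral {0..1} f"
proof -
  obtain G where G: "\<And>x. (G has_vector_derivative f x) (at x)"
    using continuous_antiderivative[OF f(1)] by blast
  note c = antiderivative_increment[OF G f(2)] and FTC = integral_01_derivative
  have "((\<lambda>x. G (x + a)) has_vector_derivative f (x + a)) (at x)" for x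
    using vector_diff_chain_at[of "\<lambda>x. x + a" 1 x G "f (x + a)"] G[of "x + a"]
    by (simp add: o_def has_vector_derivative_add_const)
  from FTC[OF this] have 1: "integral {0..1} (\<lambda>x. f (x + a)) = G (1 + a) - G a"
    by (simp add: integral_unique)
  show "integral {0..1} (\<lambda>x. f (x + a)) = integral {0..1} f"
    using 1 c[of a] by (simp add: add.commute[of 1])
  have "((\<lambda>x. - G (a - x)) has_vector_derivative f (a - x)) (at x)" for x
  proof -
    have "((\<lambda>x. a - x) has_vector_derivative - 1) (at x)"
      by (auto intro!: derivative_eq_intros)
    from vector_diff_chain_at[OF this G]
    have "((\<lambda>x. G (a - x)) has_vector_derivative - f (a - x)) (at x)" by (simp add: o_def)
    from has_vector_derivative_minus[OF this] show ?thesis by simp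
  qed
  from FTC[OF this] have "integral {0..1} (\<lambda>x. f (a - x)) = G a - G (a - 1)"
    by (simp add: integral_unique)
  then show "integral {0..1} (\<lambda>x. f (a - x)) = integral {0..1} f"
    using c[of "a - 1"] by simp
qed

section \<open>Completeness of the trigonometric system\<close>

lemma trig_moments_zero:
  assumes g: "continuous_on UNIV g" and 0: "\<And>k. fourier_coeff g k = 0"
  shows "integral {0..1} (\<lambda>x. of_real (g x) * cis (2 * pi * of_int m * x) *
           of_real (cos (2 * pi * (x - a))) ^ n) = 0"
proof (induction n arbitrary: m)
  case 0
  show ?case using assms(2)[of "- m"] by (simp add: fourier_coeff_def)
next
  case (Suc n)
  note cts = continuous_on_subset[OF g subset_UNIV, of "{0..1}"]
  let ?I = "\<lambda>m x. of_real (g x) * cis (2 * pi * of_int m * x) * of_real (cos (2 * pi * (x - a))) ^ n"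
  have int: "?I m integrable_on {0..1}" for m
    by (intro integrable_continuous_interval continuous_intros cts)
  have cos: "of_real (cos t) = (cis t + cis (- t)) / 2" for t
    by (simp add: complex_eq_iff)
  \<comment> \<open>A cosine is the mean of two opposite characters, so one more factor trades the
    frequency m for m + 1 and m - 1; this is why the induction leaves m arbitrary.\<close>
  have "of_real (g x) * cis (2 * pi * of_int m * x) * of_real (cos (2 * pi * (x - a))) ^ Suc n =
      cis (- 2 * pi * a) / 2 * ?I (m + 1) x + cis (2 * pi * a) / 2 * ?I (m - 1) x" for x
  proof -
    have "cis (2 * pi * of_int m * x) * of_real (cos (2 * pi * (x - a))) =
       cis (- 2 * pi * a) / 2 * cis (2 * pi * of_int (m + 1) * x) +
       cis (2 * pi * a) / 2 * cis (2 * pi * of_int (m - 1) * x)"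
      unfolding cos by (simp add: cis_mult algebra_simps add_divide_distrib)
    then have "of_real (g x) * of_real (cos (2 * pi * (x - a))) ^ n *
         (cis (2 * pi * of_int m * x) * of_real (cos (2 * pi * (x - a)))) =
       of_real (g x) * of_real (cos (2 * pi * (x - a))) ^ n *
         (cis (- 2 * pi * a) / 2 * cis (2 * pi * of_int (m + 1) * x) +
          cis (2 * pi * a) / 2 * cis (2 * pi * of_int (m - 1) * x))" by (rule arg_cong)
    then show ?thesis by (simp only: distrib_left power_Suc mult_ac)
  qed
  then have "integral {0..1} (\<lambda>x. of_real (g x) * cis (2 * pi * of_int m * x) *
           of_real (cos (2 * pi * (x - a))) ^ Suc n) =
     integral {0..1} (\<lambda>x. cis (- 2 * pi * a) / 2 * ?I (m + 1) x + cis (2 * pi * a) / 2 * ?I (m - 1) x)"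
    by (intro integral_cong) auto
  also have "\<dots> = integral {0..1} (\<lambda>x. cis (- 2 * pi * a) / 2 * ?I (m + 1) x) +
      integral {0..1} (\<lambda>x. cis (2 * pi * a) / 2 * ?I (m - 1) x)"
    by (intro integral_add integrable_on_mult_right int)
  also have "\<dots> = 0"
    unfolding integral_mult_right Suc.IH by simp
  finally show ?case .
qed

text \<open>Symmetrising g about a gives an even periodic h, which is a continuous function of cos
  (2 pi x). Weierstrass approximation on [-1, 1] then applies, and all moments of h against powers
  of this cosine vanish, so h is orthogonal to its own approximants and must be zero.\<close>

lemma fourier_coeff_zero_imp_zero:
  assumes g: "continuous_on UNIV g" "periodic g" and 0: "\<And>k. fourier_coeff g k = 0"
  shows "g a = 0"
proof -
  have cts[continuous_intros]: "continuous_on A (\<lambda>x. g (p x))" if "continuous_on A p" for p and A :: "real set"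
    using continuous_on_compose2[OF g(1) that] by simp
  have mom: "integral {0..1} (\<lambda>x. g x * cos (2 * pi * (x - a)) ^ n) = 0" for n
  proof -
    have "((\<lambda>x. g x * cos (2 * pi * (x - a)) ^ n) has_integral
        integral {0..1} (\<lambda>x. g x * cos (2 * pi * (x - a)) ^ n)) {0..1}"
      by (intro integrable_integral integrable_continuous_interval continuous_intros)
    from has_integral_linear[OF this bounded_linear_of_real[where 'a = complex]]
    have "of_real (integral {0..1} (\<lambda>x. g x * cos (2 * pi * (x - a)) ^ n)) = (0::complex)"
      using trig_moments_zero[OF g(1) 0, of 0 a n] by (auto simp: o_def dest!: integral_unique)
    then show ?thesis by simp
  qed
  define h where "h x = g (x + a) + g (a - x)" for x
  have h_cts: "continuous_on A h" for A unfolding h_def by (intro continuous_intros)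
  have pc: "continuous_on UNIV (\<lambda>x. g x * cos (2 * pi * (x - a)) ^ n)" for n
    by (intro continuous_intros)
  have per: "periodic (\<lambda>x. g x * cos (2 * pi * (x - a)) ^ n)" for n
  proof -
    have "cos (2 * pi * (x + 1 - a)) = cos (2 * pi * (x - a))" for x
      using cos_periodic[of "2 * pi * (x - a)"] by (simp add: algebra_simps)
    then show ?thesis using g(2) by (simp add: periodic_def)
  qed
  have h_mom: "integral {0..1} (\<lambda>x. h x * cos (2 * pi * x) ^ n) = 0" for n
  proof -
    have "integral {0..1} (\<lambda>x. h x * cos (2 * pi * x) ^ n) =
       integral {0..1} (\<lambda>x. g (x + a) * cos (2 * pi * (x + a - a)) ^ n) +
       integral {0..1} (\<lambda>x. g (a - x) * cos (2 * pi * (a - x - a)) ^ n)"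
      unfolding h_def
      by (subst integral_add[symmetric])
        (auto intro!: integrable_continuous_interval continuous_intros simp: algebra_simps)
    also have "integral {0..1} (\<lambda>x. g (x + a) * cos (2 * pi * (x + a - a)) ^ n) = 0"
      using integral_periodic_shift[OF pc per, of a n] mom by simp
    also have "integral {0..1} (\<lambda>x. g (a - x) * cos (2 * pi * (a - x - a)) ^ n) = 0"
      using integral_periodic_reflect[OF pc per, of a n] mom by simp
    finally show ?thesis by simp
  qed
  have h_sym: "h (1 - x) = h x" for x
    using periodic_int[OF g(2), of "a - x" 1] periodic_int[OF g(2), of "x + a" "- 1"]
    by (simp add: h_def algebra_simps)
  \<comment> \<open>\<open>arccos\<close> inverts the cosine only for x up to 1/2; the second half
    of the period is reached through \<open>h_sym\<close>.\<close>
  define F where "F y = h (arccos y / (2 * pi))" for y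
  have F_cts: "continuous_on {- 1..1} F"
    unfolding F_def by (rule continuous_on_compose2[OF h_cts[of UNIV]]) (auto intro!: continuous_intros continuous_on_arccos)
  have F_cos: "F (cos (2 * pi * x)) = h x" if "x \<in> {0..1}" for x
  proof (cases "x \<le> 1 / 2")
    case True
    then have "arccos (cos (2 * pi * x)) = 2 * pi * x" using that by (intro arccos_cos) auto
    then show ?thesis by (simp add: F_def)
  next
    case False
    have "cos (2 * pi * x) = cos (2 * pi * (1 - x))"
      by (simp add: right_diff_distrib cos_diff)
    moreover have "arccos (cos (2 * pi * (1 - x))) = 2 * pi * (1 - x)"
      using that False by (intro arccos_cos) auto
    ultimately show ?thesis by (simp add: F_def h_sym)
  qed
  have "integral {0..1} (\<lambda>x. (h x)\<^sup>2) \<le> 0 + e * integral {0..1} (\<lambda>x. \<bar>h x\<bar>)" if e: "e > 0" for e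
  proof -
    obtain p where p: "real_polynomial_function p" "\<And>y. y \<in> {- 1..1} \<Longrightarrow> \<bar>F y - p y\<bar> < e"
      using Stone_Weierstrass_real_polynomial_function[OF compact_Icc F_cts e] by blast
    then obtain c n where c: "p = (\<lambda>x. \<Sum>i\<le>n. c i * x ^ i)"
      using real_polynomial_function_iff_sum by blast
    have p0: "integral {0..1} (\<lambda>x. h x * p (cos (2 * pi * x))) = 0"
    proof -
      have "integral {0..1} (\<lambda>x. h x * p (cos (2 * pi * x))) =
         integral {0..1} (\<lambda>x. \<Sum>i\<le>n. c i * (h x * cos (2 * pi * x) ^ i))"
        by (simp add: c sum_distrib_left mult_ac)
      also have "\<dots> = (\<Sum>i\<le>n. integral {0..1} (\<lambda>x. c i * (h x * cos (2 * pi * x) ^ i)))"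
        by (intro integral_sum integrable_continuous_interval continuous_intros h_cts) auto
      also have "\<dots> = 0" using h_mom by simp
      finally show ?thesis .
    qed
    have "integral {0..1} (\<lambda>x. (h x)\<^sup>2) \<le> integral {0..1} (\<lambda>x. h x * p (cos (2 * pi * x)) + e * \<bar>h x\<bar>)"
    proof (intro integral_le integrable_continuous_interval continuous_intros h_cts)
      show "continuous_on {0..1} (\<lambda>x. p (cos (2 * pi * x)))"
        unfolding c by (intro continuous_intros)
      fix x :: real assume x: "x \<in> {0..1}"
      have "\<bar>h x - p (cos (2 * pi * x))\<bar> \<le> e"
        using p(2)[of "cos (2 * pi * x)"] F_cos[OF x] by simp
      then have "\<bar>h x * (h x - p (cos (2 * pi * x)))\<bar> \<le> e * \<bar>h x\<bar>"
        unfolding abs_mult by (subst mult.commute) (rule mult_right_mono, auto)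
      then show "(h x)\<^sup>2 \<le> h x * p (cos (2 * pi * x)) + e * \<bar>h x\<bar>"
        by (simp add: power2_eq_square right_diff_distrib)
    qed
    also have "\<dots> = integral {0..1} (\<lambda>x. h x * p (cos (2 * pi * x))) + integral {0..1} (\<lambda>x. e * \<bar>h x\<bar>)"
      unfolding c by (intro integral_add integrable_continuous_interval continuous_intros h_cts)
    also have "\<dots> = 0 + e * integral {0..1} (\<lambda>x. \<bar>h x\<bar>)" by (simp add: p0)
    finally show ?thesis .
  qed
  note le = this
  have M: "integral {0..1} (\<lambda>x. \<bar>h x\<bar>) \<ge> 0" (is "?M \<ge> 0")
    by (intro integral_nonneg integrable_continuous_interval continuous_intros h_cts) auto
  have "integral {0..1} (\<lambda>x. (h x)\<^sup>2) \<le> 0 + e" if "e > 0" for e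
  proof -
    \<comment> \<open>The summand 1 keeps the quotient defined when the L^1 norm \<open>?M\<close>
      is 0.\<close>
    have "e / (?M + 1) * ?M \<le> e" using M that by (simp add: field_simps)
    then show ?thesis using le[of "e / (?M + 1)"] M that by simp
  qed
  then have "integral {0..1} (\<lambda>x. (h x)\<^sup>2) \<le> 0" by (rule field_le_epsilon)
  moreover have "integral {0..1} (\<lambda>x. (h x)\<^sup>2) \<ge> 0"
    by (intro integral_nonneg integrable_continuous_interval continuous_intros h_cts) auto
  ultimately have "integral (cbox 0 1) (\<lambda>x. (h x)\<^sup>2) = 0" by simp
  then have "\<forall>x\<in>{0..1}. (h x)\<^sup>2 = 0"
    using integral_eq_0_iff[of 0 1 "\<lambda>x. (h x)\<^sup>2"] by (auto intro!: continuous_intros h_cts)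
  then have "h 0 = 0" by auto
  then show ?thesis by (simp add: h_def)
qed

section \<open>Fourier series\<close>

text \<open>For n nonzero, a shift by 1 / (2 n) changes the sign of the character but not its
  integral over a period, so the integral equals its own negative.\<close>

lemma integral_cis: "integral {0..1} (\<lambda>x. cis (2 * pi * of_int n * x)) = (if n = 0 then 1 else 0)"
proof (cases "n = 0")
  case False
  define I where "I = integral {0..1} (\<lambda>x. cis (2 * pi * of_int n * x))"
  let ?f = "\<lambda>x. cis (2 * pi * of_int n * x)"
  have "periodic ?f"
  proof -
    have "cis (2 * pi * of_int n * (x + 1)) = cis (2 * pi * of_int n * x) * cis (2 * pi * of_int n)" for x
      by (simp add: cis_mult algebra_simps)
    then show ?thesis by (simp add: periodic_def cis_multiple_2pi)
  qed
  then have "I = integral {0..1} (\<lambda>x. ?f (x + 1 / (2 * of_int n)))"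
    unfolding I_def by (intro integral_periodic_shift[symmetric] continuous_intros)
  moreover have "?f (x + 1 / (2 * of_int n)) = - ?f x" for x
  proof -
    have "2 * pi * of_int n * (x + 1 / (2 * of_int n)) = 2 * pi * of_int n * x + pi"
      using False by (simp add: field_simps)
    then show ?thesis by (simp flip: cis_mult)
  qed
  ultimately have "I = - I" by (simp only: I_def integral_neg)
  then show ?thesis using False by (simp add: I_def)
qed simp

lemma fourier_coeff_cnj: "fourier_coeff f (- k) = cnj (fourier_coeff f k)"
  unfolding fourier_coeff_def by (simp add: integral_cnj cis_cnj)

lemma fourier_coeff_lincomb:
  assumes "continuous_on UNIV f" "continuous_on UNIV g"
  shows "fourier_coeff (\<lambda>x. a * f x + b * g x) k = a * fourier_coeff f k + b * fourier_coeff g k"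
proof -
  note c = continuous_on_subset[OF assms(1) subset_UNIV] continuous_on_subset[OF assms(2) subset_UNIV]
  have "fourier_coeff (\<lambda>x. a * f x + b * g x) k =
    integral {0..1} (\<lambda>x. of_real a * (of_real (f x) * cis (- (2 * pi * of_int k * x))) +
      of_real b * (of_real (g x) * cis (- (2 * pi * of_int k * x))))"
    unfolding fourier_coeff_def by (intro integral_cong) (simp add: algebra_simps)
  also have "\<dots> = integral {0..1} (\<lambda>x. of_real a * (of_real (f x) * cis (- (2 * pi * of_int k * x)))) +
     integral {0..1} (\<lambda>x. of_real b * (of_real (g x) * cis (- (2 * pi * of_int k * x))))"
    by (intro integral_add integrable_continuous_interval continuous_intros c)
  finally show ?thesis by (simp add: fourier_coeff_def)
qed

lemma fourier_coeff_shift: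
  assumes "continuous_on UNIV f" "periodic f"
  shows "fourier_coeff (\<lambda>x. f (x + h)) k = cis (2 * pi * of_int k * h) * fourier_coeff f k"
proof -
  let ?F = "\<lambda>x. complex_of_real (f x) * cis (- (2 * pi * of_int k * x))"
  have "periodic ?F"
  proof -
    have "cis (- (2 * pi * of_int k * (x + 1))) = cis (- (2 * pi * of_int k * x)) * cis (2 * pi * of_int (- k))" for x
      by (simp add: cis_mult algebra_simps)
    moreover have "cis (2 * pi * of_int (- k)) = 1" by (intro cis_multiple_2pi) simp
    ultimately show ?thesis using assms(2) by (simp add: periodic_def)
  qed
  then have "fourier_coeff f k = integral {0..1} (\<lambda>x. ?F (x + h))"
    unfolding fourier_coeff_def
    by (intro integral_periodic_shift[symmetric] continuous_intros assms)
  moreover have "?F (x + h) = cis (- (2 * pi * of_int k * h)) *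
      (complex_of_real (f (x + h)) * cis (- (2 * pi * of_int k * x)))" for x
    by (simp add: cis_mult algebra_simps)
  ultimately have "fourier_coeff f k = cis (- (2 * pi * of_int k * h)) * fourier_coeff (\<lambda>x. f (x + h)) k"
    by (simp only: fourier_coeff_def integral_mult_right)
  then have "cis (2 * pi * of_int k * h) * fourier_coeff f k =
     (cis (2 * pi * of_int k * h) * cis (- (2 * pi * of_int k * h))) * fourier_coeff (\<lambda>x. f (x + h)) k"
    by simp
  then show ?thesis by (simp add: cis_mult)
qed

lemma has_vector_derivative_cis:
  "((\<lambda>x. cis (a * x)) has_vector_derivative \<i> * of_real a * cis (a * x)) (at x)"
  unfolding has_vector_derivative_complex_iff
  by (auto intro!: derivative_eq_intros simp: algebra_simps)

text \<open>Integration by parts: the product of f with the character has equal values at 0 and 1,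
  so no boundary term survives.\<close>

lemma fourier_coeff_deriv:
  assumes f: "\<And>x. (f has_real_derivative g x) (at x)" "periodic f" and g: "continuous_on UNIV g"
  shows "fourier_coeff g k = \<i> * of_real (2 * pi * of_int k) * fourier_coeff f k"
proof -
  note cg = continuous_on_subset[OF g subset_UNIV]
  have cf: "continuous_on A f" for A
    using f(1) DERIV_continuous_on has_field_derivative_at_within by blast
  let ?e = "\<lambda>x. cis (- (2 * pi * of_int k) * x)"
  have D: "((\<lambda>x. complex_of_real (f x) * ?e x) has_vector_derivative
      (of_real (f x) * (\<i> * of_real (- (2 * pi * of_int k)) * ?e x) + of_real (g x) * ?e x)) (at x)" for x
  proof -
    have "((\<lambda>x. complex_of_real (f x)) has_vector_derivative of_real (g x)) (at x)"
      using f(1)[of x] by (intro has_vector_derivative_of_real)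
        (simp add: has_real_derivative_iff_has_vector_derivative)
    from has_vector_derivative_mult[OF this has_vector_derivative_cis] show ?thesis .
  qed
  from integral_01_derivative[OF D]
  have "((\<lambda>x. of_real (f x) * (\<i> * of_real (- (2 * pi * of_int k)) * ?e x) + of_real (g x) * ?e x)
     has_integral 0) {0..1}"
    using f(2)[unfolded periodic_def, rule_format, of 0] cis_multiple_2pi[of "of_int (- k)"] by simp
  then have "0 = integral {0..1} (\<lambda>x. of_real (f x) * (\<i> * of_real (- (2 * pi * of_int k)) * ?e x) + of_real (g x) * ?e x)"
    by (rule integral_unique[symmetric])
  also have "\<dots> = integral {0..1} (\<lambda>x. - (\<i> * of_real (2 * pi * of_int k)) * (of_real (f x) * ?e x) + of_real (g x) * ?e x)"
    by (intro integral_cong) (simp add: algebra_simps)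
  also have "\<dots> = integral {0..1} (\<lambda>x. - (\<i> * of_real (2 * pi * of_int k)) * (of_real (f x) * ?e x)) +
      integral {0..1} (\<lambda>x. of_real (g x) * ?e x)"
    by (intro integral_add integrable_continuous_interval continuous_intros cf cg)
  also have "\<dots> = - (\<i> * of_real (2 * pi * of_int k)) * fourier_coeff f k + fourier_coeff g k"
    unfolding integral_mult_right fourier_coeff_def by (simp only: mult_minus_left)
  finally show ?thesis by (simp add: algebra_simps)
qed

text \<open>The Weierstrass M-test along the net of finite sets of frequencies: the error of a
  partial sum is at most the sum of \<open>norm (d k)\<close> over the complement, which does not
  involve x.\<close>

lemma uniform_limit_fourier:
  assumes d: "(\<lambda>k. norm (d k :: complex)) summable_on UNIV"
  shows "uniform_limit UNIV (\<lambda>F x. \<Sum>k\<in>F. d k * cis (2 * pi * of_int k * x))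
    (\<lambda>x. \<Sum>\<^sub>\<infinity>k. d k * cis (2 * pi * of_int k * x)) (finite_subsets_at_top UNIV)"
proof (rule uniform_limitI)
  fix e :: real assume "e > 0"
  have "((\<lambda>F. \<Sum>k\<in>F. norm (d k)) \<longlongrightarrow> (\<Sum>\<^sub>\<infinity>k. norm (d k))) (finite_subsets_at_top UNIV)"
    using infsum_tendsto[OF d] .
  moreover have "\<forall>\<^sub>F F in finite_subsets_at_top UNIV. finite (F :: int set)"
    by (rule eventually_finite_subsets_at_top_weakI)
  ultimately have "\<forall>\<^sub>F F in finite_subsets_at_top UNIV. finite F \<and>
      dist (\<Sum>k\<in>F. norm (d k)) (\<Sum>\<^sub>\<infinity>k. norm (d k)) < e"
    using \<open>e > 0\<close> by (intro eventually_conj tendstoD)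
  then
  show "\<forall>\<^sub>F F in finite_subsets_at_top UNIV. \<forall>x\<in>UNIV.
    dist (\<Sum>k\<in>F. d k * cis (2 * pi * of_int k * x)) (\<Sum>\<^sub>\<infinity>k. d k * cis (2 * pi * of_int k * x)) < e"
  proof eventually_elim
    case (elim F)
    show ?case
    proof
      fix x :: real
      let ?t = "\<lambda>k. d k * cis (2 * pi * of_int k * x)"
      have ab: "(\<lambda>k. norm (?t k)) summable_on A" for A
        using summable_on_subset_banach[OF d, of A] by (simp add: norm_mult)
      note s = abs_summable_summable[OF ab] and dA = summable_on_subset_banach[OF d subset_UNIV]
      have "infsum ?t UNIV = infsum ?t F + infsum ?t (- F)"
        using infsum_Un_disjoint[OF s s, of F "- F"] by simp
      then have "dist (\<Sum>k\<in>F. ?t k) (infsum ?t UNIV) = norm (infsum ?t (- F))"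
        using elim by (simp add: dist_norm norm_minus_commute)
      also have "\<dots> \<le> (\<Sum>\<^sub>\<infinity>k\<in>- F. norm (d k))"
        using norm_infsum_bound[OF ab, of "- F"] by (simp add: norm_mult)
      also have "\<dots> = (\<Sum>\<^sub>\<infinity>k. norm (d k)) - (\<Sum>k\<in>F. norm (d k))"
        using infsum_Un_disjoint[OF dA dA, of F "- F"] elim by simp
      also have "\<dots> < e" using elim by (simp add: dist_norm abs_less_iff)
      finally show "dist (\<Sum>k\<in>F. ?t k) (infsum ?t UNIV) < e" .
    qed
  qed
qed

lemma continuous_on_fourier:
  assumes d: "(\<lambda>k. norm (d k :: complex)) summable_on UNIV"
  shows "continuous_on A (\<lambda>x. \<Sum>\<^sub>\<infinity>k. d k * cis (2 * pi * of_int k * x))"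
  by (rule continuous_on_subset[OF uniform_limit_theorem[OF _ uniform_limit_fourier[OF d]]])
    (auto intro!: always_eventually continuous_intros)

text \<open>Uniform convergence allows summation and integration to be exchanged. Taking \<phi> to
  be a character identifies the coefficients of a synthesised series; taking \<phi> to be the
  function itself gives Parseval.\<close>

lemma has_sum_integral_fourier:
  assumes \<phi>: "continuous_on {0..1} (\<phi> :: real \<Rightarrow> complex)"
    and d: "(\<lambda>k. norm (d k :: complex)) summable_on UNIV"
  shows "((\<lambda>k. d k * integral {0..1} (\<lambda>x. \<phi> x * cis (2 * pi * of_int k * x))) has_sum
    integral {0..1} (\<lambda>x. \<phi> x * (\<Sum>\<^sub>\<infinity>k. d k * cis (2 * pi * of_int k * x)))) UNIV"
proof -
  let ?S = "\<lambda>x. \<Sum>\<^sub>\<infinity>k. d k * cis (2 * pi * of_int k * x)"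
  let ?P = "\<lambda>F x. \<Sum>k\<in>F. d k * cis (2 * pi * of_int k * x)"
  have "bounded (\<phi> ` {0..1})" "bounded (?S ` {0..1})"
    by (intro compact_imp_bounded compact_continuous_image \<phi> continuous_on_fourier d compact_Icc)+
  then have "uniform_limit {0..1} (\<lambda>F x. \<phi> x * ?P F x) (\<lambda>x. \<phi> x * ?S x) (finite_subsets_at_top UNIV)"
    by (intro uniform_lim_mult uniform_limit_on_subset[OF uniform_limit_fourier[OF d]] uniform_limit_const)
      (auto simp: o_def)
  then obtain I J where IJ: "\<And>F. ((\<lambda>x. \<phi> x * ?P F x) has_integral I F) {0..1}"
    "((\<lambda>x. \<phi> x * ?S x) has_integral J) {0..1}" "(I \<longlongrightarrow> J) (finite_subsets_at_top UNIV)"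
    by (rule uniform_limit_integral) (auto intro!: continuous_intros \<phi>)
  have "I F = (\<Sum>k\<in>F. d k * integral {0..1} (\<lambda>x. \<phi> x * cis (2 * pi * of_int k * x)))" if "finite F" for F
  proof -
    have "I F = integral {0..1} (\<lambda>x. \<Sum>k\<in>F. d k * (\<phi> x * cis (2 * pi * of_int k * x)))"
      using IJ(1)[of F] by (auto simp: sum_distrib_left mult_ac dest!: integral_unique)
    also have "\<dots> = (\<Sum>k\<in>F. integral {0..1} (\<lambda>x. d k * (\<phi> x * cis (2 * pi * of_int k * x))))"
      using that by (intro integral_sum integrable_continuous_interval continuous_intros \<phi>)
    finally show ?thesis by simp
  qed
  then have "eventually (\<lambda>F. I F = (\<Sum>k\<in>F. d k * integral {0..1} (\<lambda>x. \<phi> x * cis (2 * pi * of_int k * x))))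
      (finite_subsets_at_top UNIV)"
    by (intro eventually_finite_subsets_at_top_weakI) auto
  from tendsto_cong[OF this] IJ(3) show ?thesis
    using IJ(2) unfolding has_sum_def by (simp add: integral_unique)
qed

text \<open>The symmetry of d makes the sum of the series its own conjugate, hence real;
  orthogonality of the characters returns d as its coefficients.\<close>

lemma fourier_synthesis:
  assumes d: "(\<lambda>k. norm (d k)) summable_on UNIV" and sym: "\<And>k. d (- k) = cnj (d k)"
  obtains g where "continuous_on UNIV g" "periodic g" "\<And>k. fourier_coeff g k = d k"
    "\<And>x. of_real (g x) = (\<Sum>\<^sub>\<infinity>k. d k * cis (2 * pi * of_int k * x))"
    "\<And>x. \<bar>g x\<bar> \<le> (\<Sum>\<^sub>\<infinity>k. norm (d k))"
proof -
  define S where "S x = (\<Sum>\<^sub>\<infinity>k. d k * cis (2 * pi * of_int k * x))" for x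
  have cS: "continuous_on A S" for A unfolding S_def by (rule continuous_on_fourier[OF d])
  have "cnj (S x) = S x" for x
  proof -
    have "cnj (S x) = (\<Sum>\<^sub>\<infinity>k. d (- k) * cis (2 * pi * of_int (- k) * x))"
      unfolding S_def infsum_cnj[symmetric] by (simp add: sym cis_cnj)
    also have "\<dots> = S x"
      unfolding S_def
      by (rule infsum_reindex_bij_betw[of uminus UNIV UNIV "\<lambda>k. d k * cis (2 * pi * of_int k * x)"])
        (auto intro: bij_uminus)
    finally show ?thesis .
  qed
  then have re: "of_real (Re (S x)) = S x" for x by (metis complex_cnj_cancel_iff Reals_cnj_iff of_real_Re)
  have per: "cis (2 * pi * of_int k * (x + 1)) = cis (2 * pi * of_int k * x)" for k x
  proof -
    have "cis (2 * pi * of_int k * (x + 1)) = cis (2 * pi * of_int k * x) * cis (2 * pi * of_int k)"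
      by (simp add: cis_mult algebra_simps)
    then show ?thesis by (simp add: cis_multiple_2pi)
  qed
  show ?thesis
  proof (rule that[of "\<lambda>x. Re (S x)"])
    show "continuous_on UNIV (\<lambda>x. Re (S x))" by (intro continuous_intros cS)
    show "periodic (\<lambda>x. Re (S x))" by (simp add: periodic_def S_def per)
    show "of_real (Re (S x)) = (\<Sum>\<^sub>\<infinity>k. d k * cis (2 * pi * of_int k * x))" for x
      using re[of x] by (simp add: S_def)
    show "\<bar>Re (S x)\<bar> \<le> (\<Sum>\<^sub>\<infinity>k. norm (d k))" for x
    proof -
      have "norm (S x) \<le> (\<Sum>\<^sub>\<infinity>k. norm (d k * cis (2 * pi * of_int k * x)))"
        unfolding S_def by (rule norm_infsum_bound) (use d in \<open>simp add: norm_mult\<close>)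
      then show ?thesis using abs_Re_le_cmod[of "S x"] by (simp add: norm_mult)
    qed
    show "fourier_coeff (\<lambda>x. Re (S x)) j = d j" for j
    proof -
      let ?\<phi> = "\<lambda>x. cis (- (2 * pi * of_int j * x))"
      have eq: "integral {0..1} (\<lambda>x. ?\<phi> x * cis (2 * pi * of_int k * x)) = (if k = j then 1 else 0)" for k
      proof -
        have "?\<phi> x * cis (2 * pi * of_int k * x) = cis (2 * pi * of_int (k - j) * x)" for x
          by (simp add: cis_mult algebra_simps)
        then show ?thesis using integral_cis[of "k - j"] by simp
      qed
      have "((\<lambda>k. d k * integral {0..1} (\<lambda>x. ?\<phi> x * cis (2 * pi * of_int k * x))) has_sum
         integral {0..1} (\<lambda>x. ?\<phi> x * S x)) UNIV"
        unfolding S_def by (intro has_sum_integral_fourier d continuous_intros)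
      moreover have "((\<lambda>k. d k * integral {0..1} (\<lambda>x. ?\<phi> x * cis (2 * pi * of_int k * x))) has_sum d j) UNIV"
        unfolding eq by (rule has_sum_finite_neutralI[of "{j}"]) auto
      ultimately have "integral {0..1} (\<lambda>x. ?\<phi> x * S x) = d j" by (rule has_sum_unique)
      then show ?thesis unfolding fourier_coeff_def re by (simp add: mult.commute)
    qed
  qed
qed

lemma fourier_coeff_inject:
  assumes f: "continuous_on UNIV f" "periodic f" and g: "continuous_on UNIV g" "periodic g"
    and eq: "\<And>k. fourier_coeff f k = fourier_coeff g k"
  shows "f = g"
proof
  fix x
  have "1 * f x + (- 1) * g x = 0"
    using f g eq by (intro fourier_coeff_zero_imp_zero[of "\<lambda>x. 1 * f x + (- 1) * g x"])
      (auto intro!: continuous_intros simp: periodic_def fourier_coeff_lincomb[where a = 1 and b = "- 1", simplified])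
  then show "f x = g x" by simp
qed

text \<open>The function synthesised from the coefficients of f is continuous with the same
  coefficients, so by completeness it is f.\<close>

lemma fourier_inversion:
  assumes f: "continuous_on UNIV f" "periodic f" and s: "(\<lambda>k. norm (fourier_coeff f k)) summable_on UNIV"
  shows "of_real (f x) = (\<Sum>\<^sub>\<infinity>k. fourier_coeff f k * cis (2 * pi * of_int k * x))"
    and "\<bar>f x\<bar> \<le> (\<Sum>\<^sub>\<infinity>k. norm (fourier_coeff f k))"
proof -
  obtain g where g: "continuous_on UNIV g" "periodic g" "\<And>k. fourier_coeff g k = fourier_coeff f k"
    "\<And>x. of_real (g x) = (\<Sum>\<^sub>\<infinity>k. fourier_coeff f k * cis (2 * pi * of_int k * x))"
    "\<And>x. \<bar>g x\<bar> \<le> (\<Sum>\<^sub>\<infinity>k. norm (fourier_coeff f k))"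
    by (rule fourier_synthesis[OF s fourier_coeff_cnj]) blast
  have "f = g" using f g by (intro fourier_coeff_inject) auto
  then show "of_real (f x) = (\<Sum>\<^sub>\<infinity>k. fourier_coeff f k * cis (2 * pi * of_int k * x))"
    "\<bar>f x\<bar> \<le> (\<Sum>\<^sub>\<infinity>k. norm (fourier_coeff f k))"
    using g(4,5) by auto
qed

lemma parseval:
  assumes f: "continuous_on UNIV f" "periodic f" and s: "(\<lambda>k. norm (fourier_coeff f k)) summable_on UNIV"
  shows "((\<lambda>k. (cmod (fourier_coeff f k))\<^sup>2) has_sum integral {0..1} (\<lambda>x. (f x)\<^sup>2)) UNIV"
proof -
  note cf = continuous_on_subset[OF f(1) subset_UNIV]
  have "((\<lambda>k. fourier_coeff f k * integral {0..1} (\<lambda>x. of_real (f x) * cis (2 * pi * of_int k * x))) has_sum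
     integral {0..1} (\<lambda>x. of_real (f x) * of_real (f x))) UNIV"
    using has_sum_integral_fourier[of "\<lambda>x. of_real (f x)", OF _ s] unfolding fourier_inversion(1)[OF f s, symmetric]
    by (auto intro!: continuous_intros cf)
  moreover have "integral {0..1} (\<lambda>x. of_real (f x) * cis (2 * pi * of_int k * x)) = cnj (fourier_coeff f k)" for k
    unfolding fourier_coeff_cnj[symmetric] by (simp add: fourier_coeff_def)
  moreover have "integral {0..1} (\<lambda>x. complex_of_real (f x) * of_real (f x)) = of_real (integral {0..1} (\<lambda>x. (f x)\<^sup>2))"
  proof -
    have "((\<lambda>x. (f x)\<^sup>2) has_integral integral {0..1} (\<lambda>x. (f x)\<^sup>2)) {0..1}"
      by (intro integrable_integral integrable_continuous_interval continuous_intros cf)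
    from has_integral_linear[OF this bounded_linear_of_real[where 'a = complex]] show ?thesis
      by (auto simp: o_def power2_eq_square dest!: integral_unique)
  qed
  ultimately have "((\<lambda>k. complex_of_real ((cmod (fourier_coeff f k))\<^sup>2)) has_sum
      of_real (integral {0..1} (\<lambda>x. (f x)\<^sup>2))) UNIV"
    unfolding complex_norm_square by simp
  then show ?thesis by (simp only: has_sum_of_real_iff)
qed

text \<open>The series is not differentiated directly. The candidate derivative g is synthesised and
  integrated instead, and its antiderivative is matched with f by comparing coefficients.\<close>

lemma fourier_derivative:
  assumes f: "continuous_on UNIV f" "periodic f"
    and s: "(\<lambda>k. \<bar>2 * pi * of_int k\<bar> * norm (fourier_coeff f k)) summable_on UNIV"
  obtains g where "continuous_on UNIV g" "periodic g" "\<And>x. (f has_real_derivative g x) (at x)"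
    "\<And>k. fourier_coeff g k = \<i> * of_real (2 * pi * of_int k) * fourier_coeff f k"
proof -
  define d where "d k = \<i> * of_real (2 * pi * of_int k) * fourier_coeff f k" for k :: int
  have "(\<lambda>k. norm (d k)) summable_on UNIV" using s by (simp add: d_def norm_mult abs_mult)
  moreover have "d (- k) = cnj (d k)" for k by (simp add: d_def fourier_coeff_cnj)
  ultimately obtain g where g: "continuous_on UNIV g" "periodic g" "\<And>k. fourier_coeff g k = d k"
    using fourier_synthesis by metis
  obtain G where G: "\<And>x. (G has_vector_derivative g x) (at x)"
    using continuous_antiderivative[OF g(1)] by blast
  have "integral {0..1} g = 0"
  proof -
    have "complex_of_real (integral {0..1} g) = fourier_coeff g 0"
    proof -
      have "(g has_integral integral {0..1} g) {0..1}"
        by (intro integrable_integral integrable_continuous_interval continuous_on_subset[OF g(1)]) auto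
      from has_integral_linear[OF this bounded_linear_of_real[where 'a = complex]] show ?thesis
        by (auto simp: o_def fourier_coeff_def dest!: integral_unique)
    qed
    then show ?thesis using g(3)[of 0] by (simp add: d_def)
  qed
  then have Gper: "periodic G"
    using antiderivative_increment[OF G g(2)] by (simp add: periodic_def)
  have G': "(G has_real_derivative g x) (at x)" for x
    using G by (simp add: has_real_derivative_iff_has_vector_derivative)
  have Gc: "continuous_on UNIV G"
    using G' DERIV_continuous_on has_field_derivative_at_within by blast
  \<comment> \<open>Coefficients of nonzero frequency agree after division by 2 pi k; an
    antiderivative leaves the mean open, and c adjusts it.\<close>
  define c where "c = Re (fourier_coeff f 0 - fourier_coeff G 0)"
  have G_def': "fourier_coeff (\<lambda>x. 1 * G x + c * 1) k = fourier_coeff f k" for k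
  proof -
    have r: "fourier_coeff h 0 \<in> \<real>" for h
      using fourier_coeff_cnj[of h 0] by (simp add: Reals_cnj_iff)
    have 1: "fourier_coeff (\<lambda>x. 1) k = (if k = 0 then 1 else 0)"
      using integral_cis[of "- k"] by (simp add: fourier_coeff_def)
    have L: "fourier_coeff (\<lambda>x. 1 * G x + c * 1) k = of_real 1 * fourier_coeff G k + of_real c * fourier_coeff (\<lambda>x. 1) k"
      by (intro fourier_coeff_lincomb Gc continuous_intros)
    show ?thesis
    proof (cases "k = 0")
      case True
      have "of_real c = fourier_coeff f 0 - fourier_coeff G 0"
        unfolding c_def by (intro of_real_Re Reals_diff r)
      then show ?thesis unfolding L 1 using True by simp
    next
      case False
      then have "fourier_coeff G k = fourier_coeff f k"
        using fourier_coeff_deriv[OF G' Gper g(1), of k] g(3)[of k] by (simp add: d_def)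
      then show ?thesis unfolding L 1 using False by simp
    qed
  qed
  have "f = (\<lambda>x. 1 * G x + c * 1)"
    using f Gper Gc G_def'
    by (intro fourier_coeff_inject) (auto intro!: continuous_intros simp: periodic_def)
  then have "(f has_real_derivative g x) (at x)" for x
    by (auto intro!: derivative_eq_intros G')
  then show ?thesis using that[OF g(1,2)] g(3) by (simp add: d_def)
qed

section \<open>Sobolev spaces on the circle\<close>

abbreviation sobolev_weight :: "int \<Rightarrow> real" where
  "sobolev_weight k \<equiv> 1 + (2 * pi * of_int k)\<^sup>2"

abbreviation sobolev_term :: "nat \<Rightarrow> (real \<Rightarrow> real) \<Rightarrow> int \<Rightarrow> real" where
  "sobolev_term s f k \<equiv> sobolev_weight k ^ s * (cmod (fourier_coeff f k))\<^sup>2"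

lemma sobolev_weight_pos: "sobolev_weight k > 0"
  by (simp add: add_pos_nonneg)

lemma sobolev_weight_ge: "sobolev_weight k \<ge> 1"
  by simp

lemma sobolevD:
  assumes "f \<in> sobolev s"
  shows "continuous_on UNIV f" "periodic f" "sobolev_term s f summable_on UNIV"
  using assms by (auto simp: sobolev_def periodic_def)

lemma sobolevI:
  assumes "continuous_on UNIV f" "periodic f" "sobolev_term s f summable_on UNIV"
  shows "f \<in> sobolev s"
  using assms by (auto simp: sobolev_def periodic_def)

lemma sobolev_norm_nonneg: "sobolev_norm s f \<ge> 0"
  by (auto simp: sobolev_norm_def intro!: infsum_nonneg)

lemma sobolev_norm_squared: "(sobolev_norm s f)\<^sup>2 = (\<Sum>\<^sub>\<infinity>k. sobolev_term s f k)"
  unfolding sobolev_norm_def by (intro real_sqrt_pow2 infsum_nonneg) auto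

lemma sobolev_finite_sum_le:
  assumes "f \<in> sobolev s" "finite F"
  shows "(\<Sum>k\<in>F. sobolev_term s f k) \<le> (sobolev_norm s f)\<^sup>2"
  unfolding sobolev_norm_squared
  by (rule finite_sum_le_infsum[OF sobolevD(3)[OF assms(1)] assms(2)]) auto

lemma nonneg_summable_on_bounded:
  fixes g :: "'a \<Rightarrow> real"
  assumes "\<And>k. g k \<ge> 0" and "\<And>F. finite F \<Longrightarrow> sum g F \<le> B"
  shows "g summable_on UNIV" "infsum g UNIV \<le> B"
proof -
  show *: "g summable_on UNIV"
    using assms by (intro nonneg_bdd_above_summable_on bdd_aboveI2[where M = B]) auto
  show "infsum g UNIV \<le> B"
    by (rule infsum_le_finite_sums[OF *]) (use assms in auto)
qed

lemma sobolev_mono: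
  assumes "f \<in> sobolev (Suc s)"
  shows "f \<in> sobolev s" "sobolev_norm s f \<le> sobolev_norm (Suc s) f"
proof -
  have "sobolev_term s f k \<le> sobolev_term (Suc s) f k" for k
    using sobolev_weight_ge[of k] by (intro mult_right_mono power_increasing) auto
  then have "(\<Sum>k\<in>F. sobolev_term s f k) \<le> (sobolev_norm (Suc s) f)\<^sup>2" if "finite F" for F
    by (rule order_trans[OF sum_mono sobolev_finite_sum_le[OF assms that]])
  note nonneg_summable_on_bounded[OF _ this]
  then have *: "sobolev_term s f summable_on UNIV" "(\<Sum>\<^sub>\<infinity>k. sobolev_term s f k) \<le> (sobolev_norm (Suc s) f)\<^sup>2"
    by simp_all
  show "f \<in> sobolev s" using sobolevD[OF assms] * by (intro sobolevI)
  show "sobolev_norm s f \<le> sobolev_norm (Suc s) f"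
    by (rule power2_le_imp_le[OF _ sobolev_norm_nonneg]) (use * in \<open>simp only: sobolev_norm_squared[of s]\<close>)
qed

section \<open>The embedding of H^1 into the continuous functions, and derivatives of Sobolev
  functions\<close>

lemma inverse_sobolev_weight_summable: "(\<lambda>k. 1 / sobolev_weight k) summable_on UNIV"
proof -
  have nat: "(\<lambda>n. 1 / sobolev_weight (int n)) summable_on UNIV"
  proof -
    have le: "norm (1 / sobolev_weight (int n)) \<le> inverse (real n ^ 2)" if "n \<ge> 1" for n
    proof -
      have "1 \<le> (2 * pi)" using pi_gt3 by linarith
      then have "real n \<le> 2 * pi * real n" by (simp add: mult_le_cancel_right1)
      then have "real n ^ 2 \<le> sobolev_weight (int n)"
        using power_mono[of "real n" "2 * pi * real n" 2] unfolding of_int_of_nat_eq by linarith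
      then show ?thesis using that sobolev_weight_pos[of "int n"]
        by (simp add: divide_inverse le_imp_inverse_le)
    qed
    have "summable (\<lambda>n. 1 / sobolev_weight (int n))"
      by (rule summable_comparison_test[OF _ inverse_power_summable[of 2]]) (use le in auto)
    then show ?thesis by (intro summable_nonneg_imp_summable_on) auto
  qed
  have "(\<lambda>k. 1 / sobolev_weight k) summable_on range int"
    using nat by (subst summable_on_reindex) (auto simp: o_def)
  moreover have "(\<lambda>k. 1 / sobolev_weight k) summable_on range (\<lambda>n. - int n)"
    using nat by (subst summable_on_reindex) (auto simp: o_def inj_on_def)
  moreover have "range int \<union> range (\<lambda>n. - int n) = UNIV"
  proof -
    have "k \<in> range int \<union> range (\<lambda>n. - int n)" for k :: int
      by (cases k rule: int_cases2) auto
    then show ?thesis by blast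
  qed
  ultimately show ?thesis by (metis summable_on_union)
qed

definition sobolev_embed_const :: real where
  "sobolev_embed_const = sqrt (\<Sum>\<^sub>\<infinity>k. 1 / sobolev_weight k)"

lemma sobolev_embed_const_nonneg: "sobolev_embed_const \<ge> 0"
  using sobolev_weight_pos unfolding sobolev_embed_const_def
  by (auto intro!: infsum_nonneg simp: less_imp_le)

text \<open>Cauchy-Schwarz after splitting each term as (1 / sqrt weight) times (sqrt weight *
  norm). It is stated for arbitrary coefficients because \<open>sobolev_deriv\<close> applies it to
  those of a derivative whose existence is still to be shown.\<close>

lemma weighted_abs_summable:
  fixes d :: "int \<Rightarrow> complex"
  assumes "\<And>F. finite F \<Longrightarrow> (\<Sum>k\<in>F. sobolev_weight k * (norm (d k))\<^sup>2) \<le> N\<^sup>2" and "N \<ge> 0"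
  shows "(\<lambda>k. norm (d k)) summable_on UNIV" "(\<Sum>\<^sub>\<infinity>k. norm (d k)) \<le> sobolev_embed_const * N"
proof -
  have "(\<Sum>k\<in>F. norm (d k)) \<le> sobolev_embed_const * N" if F: "finite F" for F
  proof -
    have w: "sqrt (sobolev_weight k) > 0" for k using sobolev_weight_pos by simp
    have w2: "(sqrt (sobolev_weight k))\<^sup>2 = sobolev_weight k" for k by simp
    have "(\<Sum>k\<in>F. norm (d k)) = (\<Sum>k\<in>F. (1 / sqrt (sobolev_weight k)) * (sqrt (sobolev_weight k) * norm (d k)))"
      using w by (intro sum.cong) (auto simp: less_imp_neq[symmetric])
    then have "(\<Sum>k\<in>F. norm (d k))\<^sup>2 \<le> (\<Sum>k\<in>F. (1 / sqrt (sobolev_weight k))\<^sup>2) * (\<Sum>k\<in>F. (sqrt (sobolev_weight k) * norm (d k))\<^sup>2)"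
      by (simp only: Cauchy_Schwarz_ineq_sum)
    also have "\<dots> = (\<Sum>k\<in>F. 1 / sobolev_weight k) * (\<Sum>k\<in>F. sobolev_weight k * (norm (d k))\<^sup>2)"
      by (intro arg_cong2[where f = "(*)"] sum.cong refl)
        (simp_all only: power_divide power_mult_distrib[of "sqrt a" for a] w2 power_one)
    also have "\<dots> \<le> (\<Sum>\<^sub>\<infinity>k. 1 / sobolev_weight k) * N\<^sup>2"
      using sobolev_weight_pos
      by (intro mult_mono assms F finite_sum_le_infsum inverse_sobolev_weight_summable)
        (auto intro!: sum_nonneg infsum_nonneg simp: less_imp_le)
    also have "\<dots> = (sobolev_embed_const * N)\<^sup>2"
      using sobolev_weight_pos
      by (simp add: sobolev_embed_const_def power_mult_distrib infsum_nonneg less_imp_le)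
    finally show ?thesis
      by (rule power2_le_imp_le) (simp add: sobolev_embed_const_nonneg assms)
  qed
  note nonneg_summable_on_bounded[OF _ this]
  then show "(\<lambda>k. norm (d k)) summable_on UNIV" "(\<Sum>\<^sub>\<infinity>k. norm (d k)) \<le> sobolev_embed_const * N"
    by simp_all
qed

lemma sobolev_1_if_ge:
  assumes "f \<in> sobolev (Suc s)"
  shows "f \<in> sobolev 1" "sobolev_norm 1 f \<le> sobolev_norm (Suc s) f"
  using assms
proof (induction s)
  case (Suc s)
  { case 1 then show ?case using Suc.IH(1) sobolev_mono(1) by blast }
  { case 2 then show ?case using Suc.IH(2) sobolev_mono[OF 2] by force }
qed simp_all

lemma sobolev_sup_bound:
  assumes "f \<in> sobolev (Suc s)"
  shows "(\<lambda>k. norm (fourier_coeff f k)) summable_on UNIV"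
    and "\<bar>f x\<bar> \<le> sobolev_embed_const * sobolev_norm (Suc s) f"
proof -
  note f = sobolev_1_if_ge[OF assms]
  note * = weighted_abs_summable[OF sobolev_finite_sum_le[OF f(1), simplified] sobolev_norm_nonneg]
  show "(\<lambda>k. norm (fourier_coeff f k)) summable_on UNIV" by (rule *)
  from fourier_inversion(2)[OF sobolevD(1,2)[OF f(1)] this, of x] *(2)
  have "\<bar>f x\<bar> \<le> sobolev_embed_const * sobolev_norm 1 f" by simp
  also have "\<dots> \<le> sobolev_embed_const * sobolev_norm (Suc s) f"
    by (intro mult_left_mono f sobolev_embed_const_nonneg)
  finally show "\<bar>f x\<bar> \<le> sobolev_embed_const * sobolev_norm (Suc s) f" .
qed

text \<open>Multiplication by 2 pi k costs one power of the weight, since (2 pi k)^2 is at most the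
  weight. Starting from order at least 2 leaves one power over, and that power makes the
  coefficients of the derivative absolutely summable.\<close>

lemma sobolev_deriv:
  assumes f: "f \<in> sobolev (Suc (Suc s))"
  shows "(f has_real_derivative deriv f x) (at x)"
    and "deriv f \<in> sobolev (Suc s)"
    and "sobolev_norm (Suc s) (deriv f) \<le> sobolev_norm (Suc (Suc s)) f"
    and "fourier_coeff (deriv f) k = \<i> * of_real (2 * pi * of_int k) * fourier_coeff f k"
proof -
  define d where "d k = \<i> * of_real (2 * pi * of_int k) * fourier_coeff f k" for k
  have nd: "(norm (d k))\<^sup>2 = (2 * pi * of_int k)\<^sup>2 * (cmod (fourier_coeff f k))\<^sup>2" for k
    by (simp add: d_def norm_mult abs_mult power_mult_distrib)
  have le: "sobolev_weight k ^ Suc s * (norm (d k))\<^sup>2 \<le> sobolev_term (Suc (Suc s)) f k" for k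
  proof -
    have "sobolev_weight k ^ Suc s * ((2 * pi * of_int k)\<^sup>2 * (cmod (fourier_coeff f k))\<^sup>2) \<le>
       sobolev_weight k ^ Suc s * (sobolev_weight k * (cmod (fourier_coeff f k))\<^sup>2)"
      by (intro mult_left_mono mult_right_mono zero_le_power) auto
    then show ?thesis by (simp add: nd mult_ac)
  qed
  have fin: "(\<Sum>k\<in>F. sobolev_weight k ^ Suc s * (norm (d k))\<^sup>2) \<le> (sobolev_norm (Suc (Suc s)) f)\<^sup>2"
    if "finite F" for F
    by (rule order_trans[OF sum_mono[OF le] sobolev_finite_sum_le[OF f that]])
  have "(\<Sum>k\<in>F. sobolev_weight k * (norm (d k))\<^sup>2) \<le> (sobolev_norm (Suc (Suc s)) f)\<^sup>2" if "finite F" for F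
  proof (rule order_trans[OF sum_mono fin[OF that]])
    fix k
    have "sobolev_weight k ^ 1 \<le> sobolev_weight k ^ Suc s"
      by (rule power_increasing) auto
    then show "sobolev_weight k * (norm (d k))\<^sup>2 \<le> sobolev_weight k ^ Suc s * (norm (d k))\<^sup>2"
      by (intro mult_right_mono) auto
  qed
  from weighted_abs_summable(1)[OF this sobolev_norm_nonneg]
  have "(\<lambda>k. \<bar>2 * pi * of_int k\<bar> * norm (fourier_coeff f k)) summable_on UNIV"
    by (simp add: d_def norm_mult abs_mult)
  then obtain g where g: "continuous_on UNIV g" "periodic g" "\<And>x. (f has_real_derivative g x) (at x)"
    "\<And>k. fourier_coeff g k = \<i> * of_real (2 * pi * of_int k) * fourier_coeff f k"
    by (rule fourier_derivative[OF sobolevD(1,2)[OF f]]) blast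
  then have gd: "deriv f = g" by (auto simp: DERIV_imp_deriv)
  show "(f has_real_derivative deriv f x) (at x)" by (simp add: g gd)
  show "fourier_coeff (deriv f) k = \<i> * of_real (2 * pi * of_int k) * fourier_coeff f k" for k
    by (simp add: g gd)
  note * = nonneg_summable_on_bounded[OF _ fin, unfolded d_def, folded g(4)]
  have s: "sobolev_term (Suc s) g summable_on UNIV" by (rule *) simp
  show "deriv f \<in> sobolev (Suc s)" unfolding gd using g s by (intro sobolevI)
  have "(sobolev_norm (Suc s) g)\<^sup>2 \<le> (sobolev_norm (Suc (Suc s)) f)\<^sup>2"
    unfolding sobolev_norm_squared[of "Suc s"] by (rule *) simp
  then show "sobolev_norm (Suc s) (deriv f) \<le> sobolev_norm (Suc (Suc s)) f"
    unfolding gd using sobolev_norm_nonneg by (rule power2_le_imp_le)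
qed

text \<open>The factors 2 come from (p + q)^2 \<le> 2 p^2 + 2 q^2, applied frequency by frequency.
  This quadratic form of the triangle inequality serves for all later norm comparisons.\<close>

lemma sobolev_lincomb:
  assumes f: "f \<in> sobolev s" and g: "g \<in> sobolev s"
  shows "(\<lambda>x. a * f x + b * g x) \<in> sobolev s"
    and "(sobolev_norm s (\<lambda>x. a * f x + b * g x))\<^sup>2 \<le>
      2 * a\<^sup>2 * (sobolev_norm s f)\<^sup>2 + 2 * b\<^sup>2 * (sobolev_norm s g)\<^sup>2"
proof -
  let ?h = "\<lambda>x. a * f x + b * g x"
  have le: "sobolev_term s ?h k \<le> 2 * a\<^sup>2 * sobolev_term s f k + 2 * b\<^sup>2 * sobolev_term s g k" for k
  proof -
    have "cmod (fourier_coeff ?h k) \<le> \<bar>a\<bar> * cmod (fourier_coeff f k) + \<bar>b\<bar> * cmod (fourier_coeff g k)"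
      unfolding fourier_coeff_lincomb[OF sobolevD(1)[OF f] sobolevD(1)[OF g]]
      by (rule order_trans[OF norm_triangle_ineq]) (simp add: norm_mult)
    then have "(cmod (fourier_coeff ?h k))\<^sup>2 \<le> (\<bar>a\<bar> * cmod (fourier_coeff f k) + \<bar>b\<bar> * cmod (fourier_coeff g k))\<^sup>2"
      by (intro power_mono) auto
    also have "\<dots> \<le> 2 * (\<bar>a\<bar> * cmod (fourier_coeff f k))\<^sup>2 + 2 * (\<bar>b\<bar> * cmod (fourier_coeff g k))\<^sup>2"
      using sum_squares_bound[of "\<bar>a\<bar> * cmod (fourier_coeff f k)" "\<bar>b\<bar> * cmod (fourier_coeff g k)"]
      by (simp add: power2_sum)
    finally have "sobolev_term s ?h k \<le> sobolev_weight k ^ s *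
        (2 * (\<bar>a\<bar> * cmod (fourier_coeff f k))\<^sup>2 + 2 * (\<bar>b\<bar> * cmod (fourier_coeff g k))\<^sup>2)"
      by (intro mult_left_mono) auto
    then show ?thesis by (simp add: power_mult_distrib algebra_simps)
  qed
  have "(\<Sum>k\<in>F. sobolev_term s ?h k) \<le> 2 * a\<^sup>2 * (sobolev_norm s f)\<^sup>2 + 2 * b\<^sup>2 * (sobolev_norm s g)\<^sup>2"
    if F: "finite F" for F
  proof -
    have "(\<Sum>k\<in>F. sobolev_term s ?h k) \<le> 2 * a\<^sup>2 * (\<Sum>k\<in>F. sobolev_term s f k) + 2 * b\<^sup>2 * (\<Sum>k\<in>F. sobolev_term s g k)"
      using sum_mono[of F, OF le] by (simp only: sum.distrib sum_distrib_left)
    also have "\<dots> \<le> 2 * a\<^sup>2 * (sobolev_norm s f)\<^sup>2 + 2 * b\<^sup>2 * (sobolev_norm s g)\<^sup>2"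
      by (intro add_mono mult_left_mono sobolev_finite_sum_le f g F) auto
    finally show ?thesis .
  qed
  note * = nonneg_summable_on_bounded[OF _ this]
  have s: "sobolev_term s ?h summable_on UNIV" by (rule *) simp
  show "?h \<in> sobolev s"
    using sobolevD[OF f] sobolevD[OF g] s
    by (intro sobolevI) (auto intro!: continuous_intros simp: periodic_def)
  show "(sobolev_norm s ?h)\<^sup>2 \<le> 2 * a\<^sup>2 * (sobolev_norm s f)\<^sup>2 + 2 * b\<^sup>2 * (sobolev_norm s g)\<^sup>2"
    unfolding sobolev_norm_squared[of s ?h] by (rule *) simp
qed

lemma sobolev_diff:
  assumes "f \<in> sobolev s" "g \<in> sobolev s"
  shows "(\<lambda>x. f x - g x) \<in> sobolev s"
  using sobolev_lincomb(1)[OF assms, of 1 "- 1"] by simp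

lemma sobolev_cmult:
  assumes "f \<in> sobolev s"
  shows "(\<lambda>x. a * f x) \<in> sobolev s"
  using sobolev_lincomb(1)[OF assms assms, of a 0] by simp

section \<open>Curves in Sobolev spaces: joint continuity and classical derivatives\<close>

lemma sobolev_continuous_joint:
  assumes u: "sobolev_continuous (Suc s) I u"
  shows "continuous_on (I \<times> UNIV) (\<lambda>(t, x). u t x)"
proof (clarsimp simp: continuous_on_def)
  fix t x :: real assume t: "t \<in> I"
  note uS = u[unfolded sobolev_continuous_def]
  have ut: "u r \<in> sobolev (Suc s)" if "r \<in> I" for r using uS that by blast
  let ?F = "at (t, x) within I \<times> UNIV"
  let ?N = "\<lambda>p. sobolev_embed_const * sobolev_norm (Suc s) (\<lambda>y. u (fst p) y - u t y)"
  have "((\<lambda>r. sobolev_norm (Suc s) (\<lambda>x. u r x - u t x)) \<longlongrightarrow> 0) (at t within I)"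
    using uS t by blast
  \<comment> \<open>The given limit leaves out r = t, whereas points near (t, x) may have first
    coordinate t. Writing the limit 0 as the value at t turns it into continuity, which covers
    them.\<close>
  then have "((\<lambda>r. sobolev_norm (Suc s) (\<lambda>x. u r x - u t x)) \<longlongrightarrow> sobolev_norm (Suc s) (\<lambda>x. u t x - u t x)) (at t within I)"
    by (simp add: sobolev_norm_def fourier_coeff_def)
  then have c: "continuous (at t within I) (\<lambda>r. sobolev_norm (Suc s) (\<lambda>x. u r x - u t x))"
    by (simp add: continuous_within)
  have "(fst \<longlongrightarrow> t) ?F" using tendsto_fst[of "\<lambda>p. p" "(t, x)" ?F] by (simp add: tendsto_ident_at)
  moreover have "eventually (\<lambda>p. fst p \<in> I) ?F"
    unfolding eventually_at_filter by (intro always_eventually) auto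
  ultimately have "((\<lambda>p. sobolev_norm (Suc s) (\<lambda>y. u (fst p) y - u t y)) \<longlongrightarrow> sobolev_norm (Suc s) (\<lambda>y. u t y - u t y)) ?F"
    using continuous_within_tendsto_compose[OF c] by blast
  then have N: "(?N \<longlongrightarrow> 0) ?F"
    by (intro tendsto_mult_right_zero) (simp add: sobolev_norm_def fourier_coeff_def)
  \<comment> \<open>The change in time is small uniformly in space by the embedding; the remaining
    change in space takes place at the fixed time t.\<close>
  have 1: "((\<lambda>p. u (fst p) (snd p) - u t (snd p)) \<longlongrightarrow> 0) ?F"
  proof (rule Lim_null_comparison[OF _ N])
    show "\<forall>\<^sub>F p in ?F. norm (u (fst p) (snd p) - u t (snd p)) \<le> ?N p"
      using \<open>eventually (\<lambda>p. fst p \<in> I) ?F\<close>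
    proof eventually_elim
      case (elim p)
      then show ?case using sobolev_sup_bound(2)[OF sobolev_diff[OF ut ut[OF t]], of "fst p" "snd p"] by simp
    qed
  qed
  have "isCont (u t) x" using sobolevD(1)[OF ut[OF t]] by (simp add: continuous_on_eq_continuous_at)
  moreover have "(snd \<longlongrightarrow> x) ?F" using tendsto_snd[of "\<lambda>p. p" "(t, x)" ?F] by (simp add: tendsto_ident_at)
  ultimately have 2: "((\<lambda>p. u t (snd p)) \<longlongrightarrow> u t x) ?F" by (rule isCont_tendsto_compose)
  from tendsto_add[OF 1 2] show "((\<lambda>p. case p of (t, x) \<Rightarrow> u t x) \<longlongrightarrow> u t x) ?F"
    by (simp add: case_prod_unfold)
qed

lemma sobolev_continuous_deriv:
  assumes u: "sobolev_continuous (Suc (Suc s)) I u"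
  shows "sobolev_continuous (Suc s) I (\<lambda>t. deriv (u t))"
proof -
  note uS = u[unfolded sobolev_continuous_def]
  have ut: "u r \<in> sobolev (Suc (Suc s))" if "r \<in> I" for r using uS that by blast
  have diff: "(\<lambda>x. deriv (u r) x - deriv (u t) x) = deriv (\<lambda>x. u r x - u t x)" if "r \<in> I" "t \<in> I" for r t
    using sobolev_deriv(1)[OF ut] that
    by (intro ext DERIV_imp_deriv[symmetric]) (auto intro!: derivative_eq_intros)
  have "((\<lambda>r. sobolev_norm (Suc s) (\<lambda>x. deriv (u r) x - deriv (u t) x)) \<longlongrightarrow> 0) (at t within I)" if t: "t \<in> I" for t
  proof (rule tendsto_sandwich[OF _ _ tendsto_const])
    show "((\<lambda>r. sobolev_norm (Suc (Suc s)) (\<lambda>x. u r x - u t x)) \<longlongrightarrow> 0) (at t within I)"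
      using uS t by blast
    show "\<forall>\<^sub>F r in at t within I. 0 \<le> sobolev_norm (Suc s) (\<lambda>x. deriv (u r) x - deriv (u t) x)"
      by (simp add: sobolev_norm_nonneg)
    have "sobolev_norm (Suc s) (\<lambda>x. deriv (u r) x - deriv (u t) x) \<le> sobolev_norm (Suc (Suc s)) (\<lambda>x. u r x - u t x)"
      if "r \<in> I" for r
      unfolding diff[OF that t] using ut that t by (intro sobolev_deriv sobolev_diff)
    then show "\<forall>\<^sub>F r in at t within I. sobolev_norm (Suc s) (\<lambda>x. deriv (u r) x - deriv (u t) x)
       \<le> sobolev_norm (Suc (Suc s)) (\<lambda>x. u r x - u t x)"
      unfolding eventually_at_filter by (intro always_eventually) auto
  qed
  then show ?thesis using sobolev_deriv(2)[OF ut] by (auto simp: sobolev_continuous_def)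
qed

lemma sobolev_has_derivative_pointwise:
  assumes D: "sobolev_has_derivative (Suc s) I u v" and t: "t \<in> I"
  shows "((\<lambda>r. u r x) has_real_derivative v t x) (at t within I)"
proof -
  note DS = D[unfolded sobolev_has_derivative_def]
  have uv: "u r \<in> sobolev (Suc s)" "v r \<in> sobolev (Suc s)" if "r \<in> I" for r using DS that by blast+
  let ?q = "\<lambda>r x. (u r x - u t x) / (r - t) - v t x"
  have N: "((\<lambda>r. sobolev_embed_const * sobolev_norm (Suc s) (?q r)) \<longlongrightarrow> 0) (at t within I)"
    using DS t by (intro tendsto_mult_right_zero) blast
  have "\<bar>?q r x\<bar> \<le> sobolev_embed_const * sobolev_norm (Suc s) (?q r)" if "r \<in> I" for r
  proof (rule sobolev_sup_bound(2))
    have "(\<lambda>x. inverse (r - t) * (u r x - u t x) - v t x) \<in> sobolev (Suc s)"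
      using uv that t by (intro sobolev_diff sobolev_cmult)
    then show "?q r \<in> sobolev (Suc s)" by (simp add: divide_inverse mult.commute)
  qed
  then have "\<forall>\<^sub>F r in at t within I. norm (?q r x) \<le> sobolev_embed_const * sobolev_norm (Suc s) (?q r)"
    unfolding eventually_at_filter by (intro always_eventually) auto
  from Lim_null_comparison[OF this N]
  have "((\<lambda>r. ?q r x) \<longlongrightarrow> 0) (at t within I)" .
  then show ?thesis unfolding has_field_derivative_iff by (simp add: LIM_zero_iff)
qed

text \<open>Difference quotients in time commute with the space derivative. Combined with the
  pointwise version this yields the classical identity (u_x)_t = (u_t)_x.\<close>

lemma sobolev_has_derivative_deriv:
  assumes D: "sobolev_has_derivative (Suc (Suc s)) I u v"
  shows "sobolev_has_derivative (Suc s) I (\<lambda>t. deriv (u t)) (\<lambda>t. deriv (v t))"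
proof -
  note DS = D[unfolded sobolev_has_derivative_def]
  have uv: "u r \<in> sobolev (Suc (Suc s))" "v r \<in> sobolev (Suc (Suc s))" if "r \<in> I" for r using DS that by blast+
  let ?q = "\<lambda>t r x. (u r x - u t x) / (r - t) - v t x"
  let ?p = "\<lambda>t r x. (deriv (u r) x - deriv (u t) x) / (r - t) - deriv (v t) x"
  have qS: "?q t r \<in> sobolev (Suc (Suc s))" if "r \<in> I" "t \<in> I" for r t
  proof -
    have "(\<lambda>x. inverse (r - t) * (u r x - u t x) - v t x) \<in> sobolev (Suc (Suc s))"
      using uv that by (intro sobolev_diff sobolev_cmult)
    then show ?thesis by (simp add: divide_inverse mult.commute)
  qed
  have eq: "?p t r = deriv (?q t r)" if "r \<in> I" "t \<in> I" for r t
    using sobolev_deriv(1)[OF uv(1)] sobolev_deriv(1)[OF uv(2)] that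
    unfolding divide_inverse
    by (intro ext DERIV_imp_deriv[symmetric]) (auto intro!: derivative_eq_intros)
  have "((\<lambda>r. sobolev_norm (Suc s) (?p t r)) \<longlongrightarrow> 0) (at t within I)" if t: "t \<in> I" for t
  proof (rule tendsto_sandwich[OF _ _ tendsto_const])
    show "((\<lambda>r. sobolev_norm (Suc (Suc s)) (?q t r)) \<longlongrightarrow> 0) (at t within I)"
      using DS t by blast
    show "\<forall>\<^sub>F r in at t within I. 0 \<le> sobolev_norm (Suc s) (?p t r)"
      by (simp add: sobolev_norm_nonneg)
    have "sobolev_norm (Suc s) (?p t r) \<le> sobolev_norm (Suc (Suc s)) (?q t r)" if "r \<in> I" for r
      unfolding eq[OF that t] by (rule sobolev_deriv(3)[OF qS[OF that t]])
    then show "\<forall>\<^sub>F r in at t within I. sobolev_norm (Suc s) (?p t r) \<le> sobolev_norm (Suc (Suc s)) (?q t r)"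
      unfolding eventually_at_filter by (intro always_eventually) auto
  qed
  then show ?thesis using sobolev_deriv(2)[OF uv(1)] sobolev_deriv(2)[OF uv(2)]
    by (auto simp: sobolev_has_derivative_def)
qed

section \<open>Maximum principle for classical solutions\<close>

lemma continuous_on_joint_compose:
  assumes "continuous_on S (\<lambda>(t, x). g t x)" "continuous_on A p" "continuous_on A q"
    and "\<And>y. y \<in> A \<Longrightarrow> (p y, q y) \<in> S"
  shows "continuous_on A (\<lambda>y. g (p y) (q y))"
proof -
  have "continuous_on A (\<lambda>y. case (p y, q y) of (t, x) \<Rightarrow> g t x)"
    by (rule continuous_on_compose2[OF assms(1)]) (use assms in \<open>auto intro!: continuous_on_Pair\<close>)
  then show ?thesis by simp
qed

text \<open>If g reached 0, compactness of one period would give an earliest such time s and a point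
  y with g s y = 0. Since g is negative before s, it is nowhere positive at s, so y is a spatial
  maximum and \<open>touch\<close> applies; but a negative time derivative makes g positive just
  before s.\<close>

lemma first_touch:
  fixes g :: "real \<Rightarrow> real \<Rightarrow> real"
  assumes cont: "continuous_on ({a..b} \<times> UNIV) (\<lambda>(t, x). g t x)"
    and per: "\<And>t. t \<in> {a..b} \<Longrightarrow> periodic (g t)"
    and init: "\<And>x. g a x < 0"
    and touch: "\<And>t x. \<lbrakk>a < t; t \<le> b; g t x = 0; \<And>y. g t y \<le> 0\<rbrakk> \<Longrightarrow>
      \<exists>D<0. ((\<lambda>s. g s x) has_real_derivative D) (at t)"
    and t: "t \<in> {a..b}"
  shows "g t x < 0"
proof (rule ccontr)
  assume "\<not> g t x < 0"
  define K where "K = ({a..b} \<times> {0..1}) \<inter> (\<lambda>(t, x). g t x) -` {0..}"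
  have "closed K"
    unfolding K_def
    by (intro continuous_closed_preimage continuous_on_subset[OF cont] closed_Times closed_atLeastAtMost closed_atLeast) auto
  moreover have "bounded K"
    by (rule bounded_subset[of "{a..b} \<times> {0..1}"]) (auto simp: K_def bounded_Times)
  ultimately have "compact K" by (simp add: compact_eq_bounded_closed)
  moreover have wit: "s \<in> fst ` K" if "s \<in> {a..b}" "g s y \<ge> 0" for s y
  proof -
    have "(s, frac y) \<in> K"
      using that periodic_frac[OF per[OF that(1)], of y] frac_lt_1[of y] frac_ge_0[of y]
      by (auto simp: K_def less_imp_le)
    then show ?thesis by force
  qed
  moreover have "t \<in> fst ` K" using wit[OF t, of x] \<open>\<not> g t x < 0\<close> by simp
  ultimately obtain s where s: "s \<in> fst ` K" "\<And>r. r \<in> fst ` K \<Longrightarrow> s \<le> r"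
    using compact_attains_inf[of "fst ` K"] compact_continuous_image[OF continuous_on_fst[OF continuous_on_id], of K]
    by blast
  then obtain y where y: "s \<in> {a..b}" "g s y \<ge> 0" by (auto simp: K_def)
  have "s \<noteq> a" using init[of y] y by auto
  with y have "a < s" by simp
  have neg: "g r z < 0" if "a \<le> r" "r < s" for r z
    using wit[of r z] s(2)[of r] that y by force
  have cs: "continuous_on {a..b} (\<lambda>r. g r z)" for z
    by (rule continuous_on_joint_compose[OF cont]) (auto intro!: continuous_intros)
  have le: "g s z \<le> 0" for z
  proof (rule tendsto_upperbound)
    show "((\<lambda>r. g r z) \<longlongrightarrow> g s z) (at s within {a..<s})"
      by (rule tendsto_within_subset[of _ _ _ "{a..b}"]) (use cs[of z] y in \<open>auto simp: continuous_on_def\<close>)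
    show "\<forall>\<^sub>F r in at s within {a..<s}. g r z \<le> 0"
      using neg[of _ z] unfolding eventually_at_filter by (intro always_eventually) (auto simp: less_imp_le)
    have "at s within {a..<s} = at_left s"
      using \<open>a < s\<close> by (intro at_within_nhd[of s "{a<..}"]) auto
    then show "at s within {a..<s} \<noteq> bot" by simp
  qed
  then have "g s y = 0" using y(2) by (simp add: antisym)
  then obtain D where "D < 0" "((\<lambda>r. g r y) has_real_derivative D) (at s)"
    using touch[OF \<open>a < s\<close>] y le by auto
  then obtain d where d: "d > 0" "\<And>h. 0 < h \<Longrightarrow> h < d \<Longrightarrow> g s y < g (s - h) y"
    using DERIV_neg_dec_left by blast
  \<comment> \<open>Halving keeps h strictly below d; the second bound keeps s - h at or after a,
    where negativity is known.\<close>
  define h where "h = min (d / 2) (s - a)"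
  have "0 < h" "h < d" "h \<le> s - a" using d \<open>a < s\<close> by (auto simp: h_def)
  then show False using d(2)[of h] neg[of "s - h" y] \<open>g s y = 0\<close> by simp
qed

lemma periodic_bound:
  fixes h :: "real \<Rightarrow> real"
  assumes "continuous_on UNIV h" "periodic h"
  obtains M where "M > 0" "\<And>x. \<bar>h x\<bar> < M"
proof -
  have "bounded (h ` {0..1})"
    by (intro compact_imp_bounded compact_continuous_image continuous_on_subset[OF assms(1)]) auto
  then obtain M where M: "M > 0" "\<And>x. x \<in> {0..1} \<Longrightarrow> \<bar>h x\<bar> \<le> M"
    by (auto simp: bounded_pos)
  have "\<bar>h x\<bar> < M + 1" for x
    using M(2)[of "frac x"] periodic_frac[OF assms(2), of x] frac_lt_1[of x] frac_ge_0[of x] by auto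
  then show ?thesis using that[of "M + 1"] M(1) by simp
qed

lemma periodic_derivative:
  assumes "periodic f" "\<And>x. (f has_real_derivative f' x) (at x)"
  shows "periodic f'"
  unfolding periodic_def
proof
  fix x
  have "((\<lambda>y. f (y + 1)) has_real_derivative f' (x + 1)) (at x)"
    using assms(2)[of "x + 1"] by (simp add: DERIV_shift)
  moreover have "(\<lambda>y. f (y + 1)) = f" using assms(1) by (auto simp: periodic_def)
  ultimately show "f' (x + 1) = f' x" using assms(2)[of x] DERIV_unique by auto
qed

text \<open>Here \<open>w\<close> stands for u_x and \<open>v\<close> for u_t. The open time
  interval makes all time derivatives two-sided. For the space derivative of \<open>w\<close> mere
  existence is required: it is evaluated only at spatial extrema, where it is 0. In the last clause
  \<open>P\<close> is the mean-zero antiderivative of \<open>u t\<close>, and its bound by sup |u|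
  is what closes the estimate of u.\<close>

locale classical_solution =
  fixes \<gamma> T :: real and u w v :: "real \<Rightarrow> real \<Rightarrow> real"
  assumes gamma_pos: "\<gamma> > 0"
    and T_pos: "T > 0"
    and u_periodic: "t \<in> {0<..<T} \<Longrightarrow> periodic (u t)"
    and u_x: "t \<in> {0<..<T} \<Longrightarrow> (u t has_real_derivative w t x) (at x)"
    and w_x: "t \<in> {0<..<T} \<Longrightarrow> \<exists>q. (w t has_real_derivative q) (at x)"
    and u_t: "t \<in> {0<..<T} \<Longrightarrow> ((\<lambda>s. u s x) has_real_derivative v t x) (at t)"
    and w_t: "t \<in> {0<..<T} \<Longrightarrow> (w t has_real_derivative q) (at x) \<Longrightarrow>
      ((\<lambda>s. w s x) has_real_derivative (- (w t x)\<^sup>2 - u t x * q + \<gamma> * u t x)) (at t)"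
    and u_continuous: "continuous_on ({0<..<T} \<times> UNIV) (\<lambda>(t, x). u t x)"
    and w_continuous: "continuous_on ({0<..<T} \<times> UNIV) (\<lambda>(t, x). w t x)"
    and v_continuous: "continuous_on ({0<..<T} \<times> UNIV) (\<lambda>(t, x). v t x)"
    and antiderivative: "t \<in> {0<..<T} \<Longrightarrow> \<exists>P. periodic P \<and>
      (\<forall>x. (P has_real_derivative u t x) (at x)) \<and>
      (\<forall>x. v t x = - (u t x * w t x) + \<gamma> * P x) \<and>
      (\<forall>B. (\<forall>x. \<bar>u t x\<bar> \<le> B) \<longrightarrow> (\<forall>x. \<bar>P x\<bar> \<le> B))"
begin

lemma w_periodic: "t \<in> {0<..<T} \<Longrightarrow> periodic (w t)"
  using u_periodic u_x by (rule periodic_derivative)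

lemma joint_continuous_slice:
  assumes "continuous_on ({0<..<T} \<times> UNIV) (\<lambda>(t, x). g t x)" "t \<in> {0<..<T}"
  shows "continuous_on A (g t)"
  by (rule continuous_on_joint_compose[OF assms(1)]) (use assms(2) in \<open>auto intro!: continuous_intros\<close>)

lemmas u_slice = joint_continuous_slice[OF u_continuous]
  and w_slice = joint_continuous_slice[OF w_continuous]

text \<open>Squaring u handles both signs with one barrier. At a spatial maximum of u^2 one has u w
  = 0, so the time derivative of u^2 is 2 \<gamma> u P, hence at most 2 \<gamma> \<Phi>^2 at a
  touching point.\<close>

lemma u_bounded:
  assumes a: "a \<in> {0<..<T}"
  obtains B where "B > 0" "\<And>t x. t \<in> {a..<T} \<Longrightarrow> \<bar>u t x\<bar> \<le> B"
proof -
  obtain M where M: "M > 0" "\<And>x. \<bar>u a x\<bar> < M"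
    using periodic_bound[OF u_slice[OF a] u_periodic[OF a]] by blast
  \<comment> \<open>The rate 2 \<gamma> makes the derivative of \<Phi>^2 equal to 4 \<gamma>
    \<Phi>^2, twice the growth of u^2 at a touching point; this gives the strict inequality.\<close>
  define \<Phi> where "\<Phi> t = M * exp (2 * \<gamma> * (t - a))" for t
  have \<Phi>_pos: "\<Phi> t > 0" for t using M(1) by (simp add: \<Phi>_def)
  have lt: "(u t x)\<^sup>2 - (\<Phi> t)\<^sup>2 < 0" if t: "t \<in> {a..<T}" for t x
  proof (rule first_touch[where g = "\<lambda>t x. (u t x)\<^sup>2 - (\<Phi> t)\<^sup>2" and a = a and b = t])
    have sub: "{a..t} \<subseteq> {0<..<T}" using a t by auto
    show "continuous_on ({a..t} \<times> UNIV) (\<lambda>(t, x). (u t x)\<^sup>2 - (\<Phi> t)\<^sup>2)"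
      using continuous_on_subset[OF u_continuous, of "{a..t} \<times> UNIV"] sub
      by (auto simp: \<Phi>_def case_prod_unfold intro!: continuous_intros)
    show "periodic (\<lambda>x. (u s x)\<^sup>2 - (\<Phi> s)\<^sup>2)" if "s \<in> {a..t}" for s
      using u_periodic[of s] that sub by (auto simp: periodic_def)
    show "(u a x)\<^sup>2 - (\<Phi> a)\<^sup>2 < 0" for x
      using M abs_square_less_1 power_strict_mono[of "\<bar>u a x\<bar>" M 2] by (simp add: \<Phi>_def)
    show "t \<in> {a..t}" using t by simp
    fix s y assume s: "a < s" "s \<le> t" and eq: "(u s y)\<^sup>2 - (\<Phi> s)\<^sup>2 = 0"
      and max: "\<And>z. (u s z)\<^sup>2 - (\<Phi> s)\<^sup>2 \<le> 0"
    have sI: "s \<in> {0<..<T}" by (rule subsetD[OF sub]) (use s in auto)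
    obtain P where P: "\<And>x. v s x = - (u s x * w s x) + \<gamma> * P x"
      "\<And>B x. (\<forall>x. \<bar>u s x\<bar> \<le> B) \<Longrightarrow> \<bar>P x\<bar> \<le> B"
      using antiderivative[OF sI] by blast
    have "\<bar>u s z\<bar> \<le> \<Phi> s" for z
      using max[of z] \<Phi>_pos[of s] by (simp add: abs_le_square_iff[symmetric])
    then have uP: "\<bar>u s y\<bar> \<le> \<Phi> s" "\<bar>P y\<bar> \<le> \<Phi> s" using P(2) by blast+
    have "((\<lambda>z. (u s z)\<^sup>2) has_real_derivative 2 * u s y * w s y) (at y)"
      by (auto intro!: derivative_eq_intros u_x[OF sI])
    moreover have "(u s z)\<^sup>2 \<le> (u s y)\<^sup>2" for z using max[of z] eq by simp
    ultimately have 0: "u s y * w s y = 0"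
      using DERIV_local_max[of "\<lambda>z. (u s z)\<^sup>2" "2 * u s y * w s y" y 1] by auto
    have "u s y * P y \<le> \<Phi> s * \<Phi> s"
      using mult_mono[OF uP] \<Phi>_pos[of s] abs_le_iff[of "u s y * P y"] by (simp add: abs_mult)
    then have "\<gamma> * (u s y * P y) \<le> \<gamma> * (\<Phi> s)\<^sup>2"
      using gamma_pos by (simp add: power2_eq_square)
    moreover have "u s y * v s y = \<gamma> * (u s y * P y) - u s y * (u s y * w s y)"
      by (simp add: P(1) algebra_simps)
    ultimately have "2 * u s y * v s y - 4 * \<gamma> * (\<Phi> s)\<^sup>2 \<le> 2 * \<gamma> * (\<Phi> s)\<^sup>2 - 4 * \<gamma> * (\<Phi> s)\<^sup>2"
      unfolding 0 by linarith
    also have "\<dots> < 0" using gamma_pos \<Phi>_pos[of s] by simp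
    finally have "2 * u s y * v s y - 4 * \<gamma> * (\<Phi> s)\<^sup>2 < 0" .
    moreover have "((\<lambda>s. (u s y)\<^sup>2 - (\<Phi> s)\<^sup>2) has_real_derivative 2 * u s y * v s y - 4 * \<gamma> * (\<Phi> s)\<^sup>2) (at s)"
      unfolding \<Phi>_def by (auto intro!: derivative_eq_intros u_t[OF sI] simp: power2_eq_square)
    ultimately show "\<exists>D<0. ((\<lambda>s. (u s y)\<^sup>2 - (\<Phi> s)\<^sup>2) has_real_derivative D) (at s)" by blast
  qed
  have "\<bar>u t x\<bar> \<le> \<Phi> T" if t: "t \<in> {a..<T}" for t x
  proof -
    have "\<bar>u t x\<bar> \<le> \<Phi> t"
      using lt[OF t, of x] \<Phi>_pos[of t] by (intro power2_le_imp_le[of "\<bar>u t x\<bar>"]) auto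
    also have "\<dots> \<le> \<Phi> T" using t M(1) gamma_pos by (simp add: \<Phi>_def)
    finally show ?thesis .
  qed
  then show ?thesis using that[OF \<Phi>_pos] by blast
qed

lemma w_extremum:
  assumes t: "t \<in> {0<..<T}" and ext: "(\<forall>y. w t y \<le> w t x) \<or> (\<forall>y. w t x \<le> w t y)"
  shows "((\<lambda>s. w s x) has_real_derivative - (w t x)\<^sup>2 + \<gamma> * u t x) (at t)"
proof -
  obtain q where q: "(w t has_real_derivative q) (at x)" using w_x[OF t] by blast
  have "q = 0"
    using ext DERIV_local_max[OF q, of 1] DERIV_local_min[OF q, of 1] by auto
  then show ?thesis using w_t[OF t q] by simp
qed

lemma w_bounded_above:
  assumes a: "a \<in> {0<..<T}"
  obtains C where "\<And>t x. t \<in> {a..<T} \<Longrightarrow> w t x \<le> C"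
proof -
  obtain M where M: "M > 0" "\<And>x. \<bar>w a x\<bar> < M"
    using periodic_bound[OF w_slice[OF a] w_periodic[OF a]] by blast
  obtain B where B: "B > 0" "\<And>t x. t \<in> {a..<T} \<Longrightarrow> \<bar>u t x\<bar> \<le> B" using u_bounded[OF a] by blast
  \<comment> \<open>C exceeds the initial values, and C \<ge> 1 upgrades C > \<gamma> B to C^2 >
    \<gamma> B, so that - C^2 + \<gamma> u is negative at a touching point.\<close>
  define C where "C = M + \<gamma> * B + 1"
  have "\<gamma> * B > 0" using gamma_pos B by simp
  then have C: "C \<ge> 1" "C > \<gamma> * B" "C \<ge> M" using M by (auto simp: C_def)
  have "C \<le> C\<^sup>2" using C(1) by (intro self_le_power) auto
  with C have C2: "C\<^sup>2 > \<gamma> * B" by linarith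
  have "w t x - C < 0" if t: "t \<in> {a..<T}" for t x
  proof (rule first_touch[where g = "\<lambda>t x. w t x - C" and a = a and b = t])
    have sub: "{a..t} \<subseteq> {0<..<T}" using a t by auto
    show "continuous_on ({a..t} \<times> UNIV) (\<lambda>(t, x). w t x - C)"
      using continuous_on_subset[OF w_continuous, of "{a..t} \<times> UNIV"] sub
      by (auto simp: case_prod_unfold intro!: continuous_intros)
    show "periodic (\<lambda>x. w s x - C)" if "s \<in> {a..t}" for s
      using w_periodic[of s] that sub by (auto simp: periodic_def)
    show "w a x - C < 0" for x using M(2)[of x] C by auto
    show "t \<in> {a..t}" using t by simp
    fix s y assume s: "a < s" "s \<le> t" and eq: "w s y - C = 0" and max: "\<And>z. w s z - C \<le> 0"
    have sI: "s \<in> {0<..<T}" by (rule subsetD[OF sub]) (use s in auto)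
    have "((\<lambda>s. w s y) has_real_derivative - (w s y)\<^sup>2 + \<gamma> * u s y) (at s)"
      using max eq by (intro w_extremum[OF sI]) auto
    then have "((\<lambda>s. w s y - C) has_real_derivative - (w s y)\<^sup>2 + \<gamma> * u s y) (at s)"
      by (auto intro!: derivative_eq_intros)
    moreover have "\<gamma> * u s y \<le> \<gamma> * B"
      using B(2)[of s y] s t gamma_pos by (intro mult_left_mono) auto
    then have "- (w s y)\<^sup>2 + \<gamma> * u s y < 0" using C2 eq by simp
    ultimately show "\<exists>D<0. ((\<lambda>s. w s y - C) has_real_derivative D) (at s)" by blast
  qed
  then show ?thesis using that[of C] by (simp add: less_imp_le)
qed

text \<open>A touching point is a spatial minimum of w with w = \<phi>. There w_t = - \<phi>^2 +
  \<gamma> u \<ge> - \<phi>^2 - \<gamma> B, which exceeds the slope of the strict subsolution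
  \<phi>.\<close>

lemma lower_barrier:
  assumes b: "0 < a" "a \<le> b" "b < T"
    and B: "\<And>t x. t \<in> {a..b} \<Longrightarrow> \<bar>u t x\<bar> \<le> B"
    and \<phi>: "\<And>t. t \<in> {a..b} \<Longrightarrow> (\<phi> has_real_derivative \<phi>' t) (at t)"
    and \<phi>': "\<And>t. t \<in> {a..b} \<Longrightarrow> \<phi>' t < - (\<phi> t)\<^sup>2 - \<gamma> * B"
    and init: "\<And>x. \<phi> a < w a x"
    and t: "t \<in> {a..b}"
  shows "\<phi> t < w t x"
proof -
  have sub: "{a..b} \<subseteq> {0<..<T}" using b by auto
  have "\<phi> t - w t x < 0"
  proof (rule first_touch[where g = "\<lambda>t x. \<phi> t - w t x" and a = a and b = b])
    have "continuous_on {a..b} \<phi>"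
      by (rule DERIV_continuous_on[OF has_field_derivative_at_within[OF \<phi>]])
    then have c: "continuous_on ({a..b} \<times> UNIV) (\<lambda>p. \<phi> (fst p))"
      by (rule continuous_on_compose2) (auto intro!: continuous_intros)
    show "continuous_on ({a..b} \<times> UNIV) (\<lambda>(t, x). \<phi> t - w t x)"
      using continuous_on_subset[OF w_continuous, of "{a..b} \<times> UNIV"] sub c
      by (auto simp: case_prod_unfold intro!: continuous_intros)
    show "periodic (\<lambda>x. \<phi> s - w s x)" if "s \<in> {a..b}" for s
      using w_periodic[of s] that sub by (auto simp: periodic_def)
    show "\<phi> a - w a x < 0" for x using init[of x] by simp
    show "t \<in> {a..b}" by (rule t)
    fix s y assume s: "a < s" "s \<le> b" and eq: "\<phi> s - w s y = 0" and max: "\<And>z. \<phi> s - w s z \<le> 0"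
    have sab: "s \<in> {a..b}" using s by auto
    then have sI: "s \<in> {0<..<T}" using sub by blast
    have "((\<lambda>s. w s y) has_real_derivative - (w s y)\<^sup>2 + \<gamma> * u s y) (at s)"
      using max eq by (intro w_extremum[OF sI]) auto
    then have "((\<lambda>s. \<phi> s - w s y) has_real_derivative \<phi>' s - (- (w s y)\<^sup>2 + \<gamma> * u s y)) (at s)"
      by (intro derivative_intros \<phi>[OF sab])
    moreover have "\<gamma> * - u s y \<le> \<gamma> * B"
      using B[OF sab, of y] gamma_pos by (intro mult_left_mono) auto
    then have "\<phi>' s - (- (w s y)\<^sup>2 + \<gamma> * u s y) < 0" using \<phi>'[OF sab] eq by simp
    ultimately show "\<exists>D<0. ((\<lambda>s. \<phi> s - w s y) has_real_derivative D) (at s)" by blast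
  qed
  then show ?thesis by simp
qed

text \<open>Time is reversed by s -> b - s, which flips the sign of the derivative, so now a strict
  supersolution is kept below w. Equivalently, once the minimum of w has fallen to \<psi> or below
  it, it cannot be above \<psi> later on.\<close>

lemma backward_barrier:
  assumes b: "0 < a" "a \<le> b" "b < T"
    and B: "\<And>t x. t \<in> {a..b} \<Longrightarrow> \<bar>u t x\<bar> \<le> B"
    and \<psi>: "\<And>t. t \<in> {a..b} \<Longrightarrow> (\<psi> has_real_derivative \<psi>' t) (at t)"
    and \<psi>': "\<And>t. t \<in> {a..b} \<Longrightarrow> \<psi>' t > - (\<psi> t)\<^sup>2 + \<gamma> * B"
    and init: "\<And>x. \<psi> b < w b x"
  shows "\<psi> a < w a x"
proof -
  have sub: "{a..b} \<subseteq> {0<..<T}" using b by auto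
  have "\<psi> (b - (b - a)) - w (b - (b - a)) x < 0"
  proof (rule first_touch[where g = "\<lambda>s x. \<psi> (b - s) - w (b - s) x" and a = 0 and b = "b - a"])
    have "continuous_on {a..b} \<psi>"
      by (rule DERIV_continuous_on[OF has_field_derivative_at_within[OF \<psi>]])
    then have c: "continuous_on ({0..b - a} \<times> UNIV) (\<lambda>p. \<psi> (b - fst p))"
      by (rule continuous_on_compose2) (auto intro!: continuous_intros)
    have "continuous_on ({0..b - a} \<times> UNIV) (\<lambda>p. w (b - fst p) (snd p))"
      by (rule continuous_on_joint_compose[OF w_continuous]) (use b in \<open>auto intro!: continuous_intros\<close>)
    with c show "continuous_on ({0..b - a} \<times> UNIV) (\<lambda>(s, x). \<psi> (b - s) - w (b - s) x)"
      by (auto simp: case_prod_unfold intro!: continuous_intros)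
    show "periodic (\<lambda>x. \<psi> (b - s) - w (b - s) x)" if "s \<in> {0..b - a}" for s
      using w_periodic[of "b - s"] that b by (auto simp: periodic_def)
    show "\<psi> (b - 0) - w (b - 0) x < 0" for x using init[of x] by simp
    show "b - a \<in> {0..b - a}" using b by simp
    fix s y assume s: "0 < s" "s \<le> b - a" and eq: "\<psi> (b - s) - w (b - s) y = 0"
      and max: "\<And>z. \<psi> (b - s) - w (b - s) z \<le> 0"
    define r where "r = b - s"
    have rI: "r \<in> {0<..<T}" and rab: "r \<in> {a..b}" using s b by (auto simp: r_def)
    have "((\<lambda>s. w s y) has_real_derivative - (w r y)\<^sup>2 + \<gamma> * u r y) (at r)"
      using max eq by (intro w_extremum[OF rI]) (auto simp: r_def)
    then have 1: "((\<lambda>s. \<psi> s - w s y) has_real_derivative \<psi>' r - (- (w r y)\<^sup>2 + \<gamma> * u r y)) (at r)"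
      by (intro derivative_intros \<psi>[OF rab])
    have 2: "((\<lambda>s. b - s) has_real_derivative - 1) (at s)" by (auto intro!: derivative_eq_intros)
    have "((\<lambda>s. \<psi> (b - s) - w (b - s) y) has_real_derivative
        (\<psi>' r - (- (w r y)\<^sup>2 + \<gamma> * u r y)) * - 1) (at s)"
      by (rule DERIV_chain2[OF 1[unfolded r_def] 2, folded r_def])
    moreover have "\<gamma> * u r y \<le> \<gamma> * B"
      using B[OF rab, of y] gamma_pos by (intro mult_left_mono) auto
    then have "(\<psi>' r - (- (w r y)\<^sup>2 + \<gamma> * u r y)) * - 1 < 0" using \<psi>'[OF rab] eq by (simp add: r_def)
    ultimately show "\<exists>D<0. ((\<lambda>s. \<psi> (b - s) - w (b - s) y) has_real_derivative D) (at s)" by blast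
  qed
  then show ?thesis by simp
qed

end

section \<open>Energy estimate for third differences\<close>

definition fdiff :: "real \<Rightarrow> (real \<Rightarrow> real) \<Rightarrow> real \<Rightarrow> real" where
  "fdiff h f x = f (x + h) - f x"

lemma continuous_on_shift:
  assumes "continuous_on UNIV (f :: real \<Rightarrow> 'a::topological_space)"
  shows "continuous_on A (\<lambda>x. f (x + h))"
  by (rule continuous_on_compose2[OF assms]) (auto intro!: continuous_intros)

lemma fdiff_continuous: "continuous_on UNIV f \<Longrightarrow> continuous_on A (fdiff h f)"
  unfolding fdiff_def[abs_def]
  by (intro continuous_on_diff continuous_on_shift) (auto intro: continuous_on_subset)

lemma fdiff_periodic: "periodic f \<Longrightarrow> periodic (fdiff h f)"
  using periodic_shift[of f h] unfolding periodic_def fdiff_def by metis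

lemma fdiff_deriv:
  assumes "\<And>x. (f has_real_derivative f' x) (at x)"
  shows "(fdiff h f has_real_derivative fdiff h f' x) (at x)"
proof -
  have "((\<lambda>z. f (z + h)) has_real_derivative f' (x + h)) (at x)"
    using assms[of "x + h"] by (simp add: DERIV_shift)
  then show ?thesis unfolding fdiff_def[abs_def] by (intro DERIV_diff assms)
qed

lemma fourier_coeff_fdiff:
  assumes "continuous_on UNIV f" "periodic f"
  shows "fourier_coeff (fdiff h f) k = (cis (2 * pi * of_int k * h) - 1) * fourier_coeff f k"
proof -
  have "fourier_coeff (\<lambda>x. 1 * f (x + h) + (- 1) * f x) k =
      of_real 1 * fourier_coeff (\<lambda>x. f (x + h)) k + of_real (- 1) * fourier_coeff f k"
    by (intro fourier_coeff_lincomb assms continuous_on_shift)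
  then show ?thesis
    unfolding fdiff_def[abs_def] fourier_coeff_shift[OF assms] by (simp add: algebra_simps)
qed

lemma fdiff_funpow:
  assumes f: "continuous_on UNIV f" "periodic f"
  shows "continuous_on UNIV ((fdiff h ^^ j) f)" "periodic ((fdiff h ^^ j) f)"
    "fourier_coeff ((fdiff h ^^ j) f) k = (cis (2 * pi * of_int k * h) - 1) ^ j * fourier_coeff f k"
proof (induction j)
  case (Suc j)
  { case 1 show ?case using fdiff_continuous[OF Suc.IH(1)] by simp }
  { case 2 show ?case using fdiff_periodic[OF Suc.IH(2)] by simp }
  { case 3 show ?case using fourier_coeff_fdiff[OF Suc.IH(1,2)] Suc.IH(3) by simp }
qed (use f in simp_all)

lemma norm_cis_minus_1: "norm (cis \<theta> - 1) = 2 * \<bar>sin (\<theta> / 2)\<bar>"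
proof -
  have "(norm (cis \<theta> - 1))\<^sup>2 = 2 - 2 * cos \<theta>"
    using sin_cos_squared_add[of \<theta>] by (simp add: cmod_power2 power2_diff)
  also have "cos \<theta> = 1 - 2 * (sin (\<theta> / 2))\<^sup>2"
    using cos_double_sin[of "\<theta> / 2"] by simp
  also have "2 - 2 * (1 - 2 * (sin (\<theta> / 2))\<^sup>2) = (2 * \<bar>sin (\<theta> / 2)\<bar>)\<^sup>2"
    by (simp add: power_mult_distrib)
  finally show ?thesis by (rule power2_eq_imp_eq) simp_all
qed

lemma norm_cis_minus_1_le: "norm (cis \<theta> - 1) \<le> \<bar>\<theta>\<bar>"
  using abs_sin_x_le_abs_x[of "\<theta> / 2"] by (simp add: norm_cis_minus_1)

text \<open>Each difference multiplies the coefficient of frequency k by cis (2 pi k h) - 1. The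
  crude bound 2 for this factor preserves absolute summability.\<close>

lemma parseval_fdiff:
  assumes f: "continuous_on UNIV f" "periodic f" and s: "(\<lambda>k. norm (fourier_coeff f k)) summable_on UNIV"
  shows "((\<lambda>k. norm (cis (2 * pi * of_int k * h) - 1) ^ (2 * j) * (cmod (fourier_coeff f k))\<^sup>2) has_sum
    integral {0..1} (\<lambda>x. ((fdiff h ^^ j) f x)\<^sup>2)) UNIV"
proof -
  have le2: "norm (cis \<theta> - 1) \<le> 2" for \<theta>
    using abs_sin_le_one[of "\<theta> / 2"] by (simp add: norm_cis_minus_1)
  have "(\<lambda>k. norm (fourier_coeff ((fdiff h ^^ j) f) k)) summable_on UNIV"
    unfolding fdiff_funpow(3)[OF f]
  proof (rule Infinite_Sum.abs_summable_on_comparison_test[where g = "\<lambda>k. 2 ^ j * fourier_coeff f k"])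
    show "(\<lambda>k. norm (2 ^ j * fourier_coeff f k)) summable_on UNIV"
      using summable_on_cmult_right[OF s, of "2 ^ j"] by (simp add: norm_mult norm_power)
    show "norm ((cis (2 * pi * of_int k * h) - 1) ^ j * fourier_coeff f k) \<le> norm (2 ^ j * fourier_coeff f k)" for k
      using le2 by (simp add: norm_mult norm_power mult_right_mono power_mono)
  qed
  from parseval[OF fdiff_funpow(1,2)[OF f] this] show ?thesis
    unfolding fdiff_funpow(3)[OF f] by (simp add: norm_mult norm_power power_mult_distrib power_mult[symmetric] mult.commute)
qed

text \<open>Both follow from |cis \<theta> - 1| \<le> |\<theta>| with \<theta> = 2 pi k h. In the
  second bound two differences give h^4 (2 pi k)^4 and the derivative gives the remaining (2 pi
  k)^2, so that again the cube of the weight appears.\<close>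

lemma
  assumes f: "f \<in> sobolev 3"
  shows L2_fdiff3_le: "integral {0..1} (\<lambda>x. ((fdiff h ^^ 3) f x)\<^sup>2) \<le> h ^ 6 * (sobolev_norm 3 f)\<^sup>2"
    and L2_fdiff2_deriv_le: "integral {0..1} (\<lambda>x. ((fdiff h ^^ 2) (deriv f) x)\<^sup>2) \<le> h ^ 4 * (sobolev_norm 3 f)\<^sup>2"
proof -
  have f3: "f \<in> sobolev (Suc (Suc (Suc 0)))" using f by (simp add: numeral_eq_Suc)
  note f' = sobolev_deriv(2)[OF f3]
  have N: "((\<lambda>k. c * sobolev_term 3 f k) has_sum c * (sobolev_norm 3 f)\<^sup>2) UNIV" for c
    unfolding sobolev_norm_squared by (intro has_sum_cmult_right has_sum_infsum sobolevD(3)[OF f])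
  have w: "(2 * pi * of_int k)\<^sup>2 ^ 3 \<le> sobolev_weight k ^ 3" for k by (intro power_mono) auto
  have "norm (cis (2 * pi * of_int k * h) - 1) ^ (2 * 3) * (cmod (fourier_coeff f k))\<^sup>2 \<le> h ^ 6 * sobolev_term 3 f k" for k
  proof -
    have "norm (cis (2 * pi * of_int k * h) - 1) ^ (2 * 3) \<le> \<bar>2 * pi * of_int k * h\<bar> ^ (2 * 3)"
      by (intro power_mono norm_cis_minus_1_le) auto
    also have "\<dots> = h ^ 6 * (2 * pi * of_int k)\<^sup>2 ^ 3"
      by (simp add: power_mult_distrib abs_mult power_mult[symmetric] power_even_abs)
    also have "\<dots> \<le> h ^ 6 * sobolev_weight k ^ 3" by (intro mult_left_mono w) auto
    finally show ?thesis by (simp add: mult_right_mono mult.assoc[symmetric])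
  qed
  then show "integral {0..1} (\<lambda>x. ((fdiff h ^^ 3) f x)\<^sup>2) \<le> h ^ 6 * (sobolev_norm 3 f)\<^sup>2"
    by (intro has_sum_mono[OF parseval_fdiff[OF sobolevD(1,2)[OF f] sobolev_sup_bound(1)[OF f3]] N])
  have "norm (cis (2 * pi * of_int k * h) - 1) ^ (2 * 2) * (cmod (fourier_coeff (deriv f) k))\<^sup>2 \<le> h ^ 4 * sobolev_term 3 f k" for k
  proof -
    have "norm (cis (2 * pi * of_int k * h) - 1) ^ (2 * 2) * (2 * pi * of_int k)\<^sup>2 \<le> \<bar>2 * pi * of_int k * h\<bar> ^ (2 * 2) * (2 * pi * of_int k)\<^sup>2"
      by (intro mult_right_mono power_mono norm_cis_minus_1_le) auto
    also have "\<dots> = h ^ 4 * (2 * pi * of_int k)\<^sup>2 ^ 3"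
      by (simp add: power_mult_distrib power_mult[symmetric] power_even_abs mult_ac flip: power_add)
    also have "\<dots> \<le> h ^ 4 * sobolev_weight k ^ 3" by (intro mult_left_mono w) auto
    finally have "norm (cis (2 * pi * of_int k * h) - 1) ^ (2 * 2) * (2 * pi * of_int k)\<^sup>2 * (cmod (fourier_coeff f k))\<^sup>2 \<le>
       h ^ 4 * sobolev_weight k ^ 3 * (cmod (fourier_coeff f k))\<^sup>2" by (intro mult_right_mono) auto
    moreover have "(cmod (fourier_coeff (deriv f) k))\<^sup>2 = (2 * pi * of_int k)\<^sup>2 * (cmod (fourier_coeff f k))\<^sup>2"
      unfolding sobolev_deriv(4)[OF f3] by (simp add: norm_mult abs_mult power_mult_distrib)
    ultimately show ?thesis by (simp only: mult.assoc)
  qed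
  then show "integral {0..1} (\<lambda>x. ((fdiff h ^^ 2) (deriv f) x)\<^sup>2) \<le> h ^ 4 * (sobolev_norm 3 f)\<^sup>2"
    by (intro has_sum_mono[OF parseval_fdiff[OF sobolevD(1,2)[OF f'] sobolev_sup_bound(1)[OF f']] N])
qed

text \<open>
  The factor 8 comes from \<open>(1 + y)\<^sup>3 \<le> (2 y)\<^sup>3\<close> for \<open>y = (2 \<pi> k)\<^sup>2 \<ge> 1\<close>; the mode \<open>k = 0\<close> vanishes.
\<close>

lemma sobolev_norm_le_fdiff3:
  assumes f: "f \<in> sobolev 3" and f0: "fourier_coeff f 0 = 0"
    and le: "\<And>h. h > 0 \<Longrightarrow> integral {0..1} (\<lambda>x. ((fdiff h ^^ 3) f x)\<^sup>2) \<le> h ^ 6 * K"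
  shows "(sobolev_norm 3 f)\<^sup>2 \<le> 8 * K"
proof -
  have f3: "f \<in> sobolev (Suc (Suc (Suc 0)))" using f by (simp add: numeral_eq_Suc)
  have fin: "(\<Sum>k\<in>F. (2 * pi * of_int k)\<^sup>2 ^ 3 * (cmod (fourier_coeff f k))\<^sup>2) \<le> K" if F: "finite F" for F
  \<comment> \<open>The bound is passed to the limit h -> 0 on a finite set of frequencies: the
    symbol of the difference quotient, 2 sin (pi k h) / h in modulus, tends to 2 pi k.\<close>
  proof (rule tendsto_upperbound)
    let ?s = "\<lambda>h k. (2 * (sin (pi * of_int k * h) / h))\<^sup>2 ^ 3 * (cmod (fourier_coeff f k))\<^sup>2"
    have "((\<lambda>h. sin (pi * of_int k * h) / h) \<longlongrightarrow> pi * of_int k) (at_right 0)" for k :: int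
    proof -
      have "((\<lambda>h. sin (pi * of_int k * h)) has_real_derivative pi * of_int k) (at 0)"
        by (auto intro!: derivative_eq_intros)
      then show ?thesis
        by (auto simp: has_field_derivative_iff intro: tendsto_within_subset)
    qed
    then have "((\<lambda>h. ?s h k) \<longlongrightarrow> (2 * (pi * of_int k))\<^sup>2 ^ 3 * (cmod (fourier_coeff f k))\<^sup>2) (at_right 0)" for k
      by (intro tendsto_intros)
    then show "((\<lambda>h. \<Sum>k\<in>F. ?s h k) \<longlongrightarrow> (\<Sum>k\<in>F. (2 * pi * of_int k)\<^sup>2 ^ 3 * (cmod (fourier_coeff f k))\<^sup>2)) (at_right 0)"
      by (intro tendsto_sum) (simp add: mult.assoc)
    have "(\<Sum>k\<in>F. ?s h k) \<le> K" if h: "h > 0" for h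
    proof -
      have "?s h k = norm (cis (2 * pi * of_int k * h) - 1) ^ (2 * 3) * (cmod (fourier_coeff f k))\<^sup>2 / h ^ 6" for k
      proof -
        have "(2 * (sin (pi * of_int k * h) / h))\<^sup>2 = (norm (cis (2 * pi * of_int k * h) - 1))\<^sup>2 / h\<^sup>2"
          by (simp add: norm_cis_minus_1 power_mult_distrib power_divide mult.assoc)
        then have "((2 * (sin (pi * of_int k * h) / h))\<^sup>2) ^ 3 = ((norm (cis (2 * pi * of_int k * h) - 1))\<^sup>2 / h\<^sup>2) ^ 3"
          by (rule arg_cong)
        also have "\<dots> = norm (cis (2 * pi * of_int k * h) - 1) ^ (2 * 3) / h ^ 6"
          by (simp add: power_divide flip: power_mult)
        finally show ?thesis by (simp only: times_divide_eq_left)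
      qed
      then have "(\<Sum>k\<in>F. ?s h k) = (\<Sum>k\<in>F. norm (cis (2 * pi * of_int k * h) - 1) ^ (2 * 3) * (cmod (fourier_coeff f k))\<^sup>2) / h ^ 6"
        by (simp only: sum_divide_distrib)
      also have "\<dots> \<le> integral {0..1} (\<lambda>x. ((fdiff h ^^ 3) f x)\<^sup>2) / h ^ 6"
        using h F
        by (intro divide_right_mono finite_sum_le_has_sum[OF parseval_fdiff[OF sobolevD(1,2)[OF f] sobolev_sup_bound(1)[OF f3]]]) auto
      also have "\<dots> \<le> K" using le[OF h] h by (simp add: divide_le_eq mult.commute)
      finally show ?thesis .
    qed
    then show "\<forall>\<^sub>F h in at_right 0. (\<Sum>k\<in>F. ?s h k) \<le> K"
      using eventually_at_right_less[of 0] by (auto elim!: eventually_mono)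
  qed simp
  have "sobolev_term 3 f k \<le> 8 * ((2 * pi * of_int k)\<^sup>2 ^ 3 * (cmod (fourier_coeff f k))\<^sup>2)" for k
  proof (cases "k = 0")
    case False
    then have k: "1 \<le> \<bar>of_int k :: real\<bar>" by (metis int_one_le_iff_zero_less of_int_1_le_iff of_int_abs zero_less_abs_iff)
    have "1 * 1 \<le> 2 * pi * \<bar>of_int k\<bar>" using k pi_gt3 by (intro mult_mono) auto
    then have "1 \<le> \<bar>2 * pi * of_int k\<bar>" by (simp add: abs_mult)
    then have "1 \<le> (2 * pi * of_int k)\<^sup>2"
      by (metis one_le_power power2_abs)
    then have "sobolev_weight k ^ 3 \<le> (2 * (2 * pi * of_int k)\<^sup>2) ^ 3" by (intro power_mono) auto
    then have "sobolev_weight k ^ 3 \<le> 8 * (2 * pi * of_int k)\<^sup>2 ^ 3" by (simp only: power_mult_distrib) simp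
    then show ?thesis by (simp only: mult.assoc[symmetric] mult_right_mono zero_le_power2)
  qed (simp add: f0)
  then have "(\<Sum>k\<in>F. sobolev_term 3 f k) \<le> 8 * K" if "finite F" for F
    using sum_mono[of F "sobolev_term 3 f" "\<lambda>k. 8 * ((2 * pi * of_int k)\<^sup>2 ^ 3 * (cmod (fourier_coeff f k))\<^sup>2)"]
      fin[OF that] unfolding sum_distrib_left[symmetric] by force
  from nonneg_summable_on_bounded(2)[OF _ this] show ?thesis
    unfolding sobolev_norm_squared by simp
qed

lemma cube_diff_le:
  fixes a b :: real
  shows "\<bar>a ^ 3 - b ^ 3\<bar> \<le> 3 / 2 * \<bar>a - b\<bar> * (a\<^sup>2 + b\<^sup>2)"
proof -
  have "a ^ 3 - b ^ 3 = (a - b) * (a\<^sup>2 + a * b + b\<^sup>2)"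
    by (simp add: power2_eq_square power3_eq_cube algebra_simps)
  then have eq: "\<bar>a ^ 3 - b ^ 3\<bar> = \<bar>a - b\<bar> * \<bar>a\<^sup>2 + a * b + b\<^sup>2\<bar>" by (simp only: abs_mult)
  have "\<bar>a\<^sup>2 + a * b + b\<^sup>2\<bar> \<le> 3 / 2 * (a\<^sup>2 + b\<^sup>2)"
    using zero_le_power2[of "a - b"] zero_le_power2[of "a + b"] by (simp add: power2_eq_square algebra_simps abs_le_iff)
  then have "\<bar>a - b\<bar> * \<bar>a\<^sup>2 + a * b + b\<^sup>2\<bar> \<le> \<bar>a - b\<bar> * (3 / 2 * (a\<^sup>2 + b\<^sup>2))"
    by (rule mult_left_mono) simp
  then show ?thesis unfolding eq by (simp only: mult_ac)
qed

text \<open>A discrete Gagliardo--Nirenberg inequality, by summation by parts.\<close>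

lemma L4_fdiff_le:
  assumes g: "continuous_on UNIV g" "periodic g" and A: "\<And>x. \<bar>g x\<bar> \<le> A"
  shows "integral {0..1} (\<lambda>x. (fdiff h g x) ^ 4) \<le> 9 * A\<^sup>2 * integral {0..1} (\<lambda>x. (fdiff h (fdiff h g) x)\<^sup>2)"
proof -
  define a where "a = fdiff h g"
  define d where "d = fdiff h a"
  have c: "continuous_on S a" "continuous_on S d" "continuous_on S g" for S
    using g(1) fdiff_continuous unfolding a_def d_def by (auto intro: continuous_on_subset)
  have cs: "continuous_on S (\<lambda>x. a (x + h))" "continuous_on S (\<lambda>x. g (x + h))" for S
    by (intro continuous_on_shift c)+
  have pa: "periodic a" unfolding a_def by (rule fdiff_periodic[OF g(2)])
  let ?I = "\<lambda>f. integral {0..1 :: real} f"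
  have sh4: "?I (\<lambda>x. (a (x + h)) ^ 4) = ?I (\<lambda>x. (a x) ^ 4)"
    using pa by (intro integral_periodic_shift[of "\<lambda>x. (a x) ^ 4"]) (auto intro!: continuous_intros c simp: periodic_def)
  have sh3: "?I (\<lambda>x. a (x + h) ^ 3 * g (x + h)) = ?I (\<lambda>x. a x ^ 3 * g x)"
    using pa g(2) by (intro integral_periodic_shift[of "\<lambda>x. (a x) ^ 3 * g x"]) (auto intro!: continuous_intros c simp: periodic_def)
  have "?I (\<lambda>x. (a x) ^ 4) = ?I (\<lambda>x. a x ^ 3 * g (x + h) - a x ^ 3 * g x)"
    by (intro integral_cong) (simp add: a_def fdiff_def power4_eq_xxxx power3_eq_cube algebra_simps)
  \<comment> \<open>Translating the second integrand by h transfers the difference from g to the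
    cube of a, leaving g to be bounded by A.\<close>
  also have "\<dots> = ?I (\<lambda>x. a x ^ 3 * g (x + h)) - ?I (\<lambda>x. a (x + h) ^ 3 * g (x + h))"
    unfolding sh3 by (intro integral_diff integrable_continuous_interval continuous_intros c cs)
  also have "\<dots> = ?I (\<lambda>x. (a x ^ 3 - a (x + h) ^ 3) * g (x + h))"
    unfolding left_diff_distrib
    by (intro integral_diff[symmetric] integrable_continuous_interval continuous_intros c cs)
  \<comment> \<open>The weights in Young's inequality are chosen so that the fourth powers
    contribute half of the left-hand side; absorbing them doubles 9/2 to 9.\<close>
  also have "\<dots> \<le> ?I (\<lambda>x. 9 / 2 * A\<^sup>2 * (d x)\<^sup>2 + 1 / 4 * (a (x + h) ^ 4) + 1 / 4 * (a x ^ 4))"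
  proof (intro integral_le integrable_continuous_interval continuous_intros c cs)
    fix x :: real
    let ?p = "a x" and ?q = "a (x + h)"
    have A0: "A \<ge> 0" using A[of 0] by linarith
    have d: "d x = ?q - ?p" by (simp add: d_def fdiff_def)
    have "(?p ^ 3 - ?q ^ 3) * g (x + h) \<le> \<bar>?p ^ 3 - ?q ^ 3\<bar> * \<bar>g (x + h)\<bar>"
      by (simp flip: abs_mult)
    also have "\<dots> \<le> (3 / 2 * \<bar>?p - ?q\<bar> * (?p\<^sup>2 + ?q\<^sup>2)) * A"
      by (intro mult_mono cube_diff_le A) auto
    also have "\<dots> = (3 * A * \<bar>d x\<bar>) * ((?p\<^sup>2 + ?q\<^sup>2) / 2)" by (simp add: d abs_minus_commute)
    also have "\<dots> \<le> ((3 * A * \<bar>d x\<bar>)\<^sup>2 + ((?p\<^sup>2 + ?q\<^sup>2) / 2)\<^sup>2) / 2"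
      using sum_squares_bound[of "3 * A * \<bar>d x\<bar>" "(?p\<^sup>2 + ?q\<^sup>2) / 2"] by simp
    also have "((?p\<^sup>2 + ?q\<^sup>2) / 2)\<^sup>2 \<le> (?p ^ 4 + ?q ^ 4) / 2"
      using zero_le_power2[of "?p\<^sup>2 - ?q\<^sup>2"] by (simp add: power2_eq_square power4_eq_xxxx algebra_simps)
    finally show "(?p ^ 3 - ?q ^ 3) * g (x + h) \<le> 9 / 2 * A\<^sup>2 * (d x)\<^sup>2 + 1 / 4 * ?q ^ 4 + 1 / 4 * ?p ^ 4"
      by (simp add: power_mult_distrib field_simps)
  qed
  also have "\<dots> = 9 / 2 * A\<^sup>2 * ?I (\<lambda>x. (d x)\<^sup>2) + 1 / 4 * ?I (\<lambda>x. a (x + h) ^ 4) + 1 / 4 * ?I (\<lambda>x. a x ^ 4)"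
    by (simp add: integral_add integrable_continuous_interval continuous_intros c cs)
  also have "\<dots> = 9 / 2 * A\<^sup>2 * ?I (\<lambda>x. (d x)\<^sup>2) + 1 / 2 * ?I (\<lambda>x. a x ^ 4)"
    unfolding sh4 by simp
  finally show ?thesis unfolding a_def[symmetric] d_def[symmetric] by simp
qed

lemma fdiff_le_deriv:
  assumes "\<And>x. (f has_real_derivative f' x) (at x)" "\<And>x. \<bar>f' x\<bar> \<le> A" "h > 0"
  shows "\<bar>fdiff h f x\<bar> \<le> A * h"
proof -
  obtain z where "f (x + h) - f x = (x + h - x) * f' z"
    using MVT2[of x "x + h" f f'] assms by auto
  then show ?thesis using assms(2)[of z] assms(3) by (simp add: fdiff_def abs_mult mult.commute)
qed

text \<open>
  In the discrete Leibniz expansion of the third difference of \<open>f f'\<close>, the top-order term paired with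
  the third difference of \<open>f\<close> is an exact derivative (\<open>q\<close> below) up to lower order.
\<close>

lemma energy_estimate:
  assumes f: "f \<in> sobolev 3" and A: "\<And>x. \<bar>deriv f x\<bar> \<le> A" and h: "h > 0"
    and P: "\<And>x. (P has_real_derivative f x) (at x)" "periodic P"
  shows "integral {0..1} (\<lambda>x. (fdiff h ^^ 3) f x * (fdiff h ^^ 3) (\<lambda>x. - (f x * deriv f x) + \<gamma> * P x) x)
    \<le> h ^ 6 * (sobolev_norm 3 f)\<^sup>2 * (9 / 2 * A + 3 / 2 + 27 / 2 * A\<^sup>2)"
proof -
  have f3: "f \<in> sobolev (Suc (Suc (Suc 0)))" using f by (simp add: numeral_eq_Suc)
  define w where "w = deriv f"
  define N where "N = sobolev_norm 3 f"
  have f': "(f has_real_derivative w x) (at x)" for x unfolding w_def by (rule sobolev_deriv(1)[OF f3])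
  obtain w' where w': "\<And>x. (w has_real_derivative w' x) (at x)"
    using sobolev_deriv(1)[OF sobolev_deriv(2)[OF f3]] unfolding w_def by blast
  have per: "periodic f" "periodic w"
    using sobolevD(2)[OF f] sobolevD(2)[OF sobolev_deriv(2)[OF f3]] by (simp_all add: w_def)
  have cfw: "continuous_on UNIV f" "continuous_on UNIV w"
    using sobolevD(1)[OF f] sobolevD(1)[OF sobolev_deriv(2)[OF f3]] by (simp_all add: w_def)
  have A0: "A \<ge> 0" using A[of 0] by linarith
  define f1 f2 f3 w1 w2 w3 P3 where "f1 = fdiff h f" "f2 = fdiff h f1" "f3 = fdiff h f2"
    "w1 = fdiff h w" "w2 = fdiff h w1" "w3 = fdiff h w2" "P3 = fdiff h (fdiff h (fdiff h P))"
  note defs = this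
  have c: "continuous_on S f" "continuous_on S f1" "continuous_on S f2" "continuous_on S f3"
      "continuous_on S w" "continuous_on S w1" "continuous_on S w2" "continuous_on S w3" for S
    unfolding defs by (auto intro!: fdiff_continuous cfw intro: continuous_on_subset[OF cfw(1)] continuous_on_subset[OF cfw(2)])
  note cs = continuous_on_shift[OF c(1)] continuous_on_shift[OF c(2)] continuous_on_shift[OF c(3)] continuous_on_shift[OF c(5)]
    continuous_on_shift[OF continuous_on_shift[OF c(2)]] continuous_on_shift[OF continuous_on_shift[OF continuous_on_shift[OF c(5)]]]
  have D3: "(f3 has_real_derivative w3 x) (at x)" "(P3 has_real_derivative f3 x) (at x)" for x
    unfolding defs by (intro fdiff_deriv f' P)+
  have p: "periodic f1" "periodic f2" "periodic f3" "periodic P3"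
    unfolding defs by (intro fdiff_periodic per P)+
  let ?I = "\<lambda>f. integral {0..1 :: real} f"
  \<comment> \<open>The nonlocal term is exact as well: P3 has derivative f3, so \<gamma> f3 P3
    integrates to zero and \<gamma> is absent from the final constant.\<close>
  define Q where "Q x = - (f3 x)\<^sup>2 * f (x + h + h + h) / 2 + \<gamma> * (P3 x)\<^sup>2 / 2" for x
  define q where "q x = - (f3 x * w3 x * f (x + h + h + h) + (f3 x)\<^sup>2 * w (x + h + h + h) / 2) + \<gamma> * (P3 x * f3 x)" for x
  \<comment> \<open>The first term compensates the part of \<open>q\<close> coming from the
    derivative of the shifted f; the others are the Leibniz terms below top order.\<close>
  define e where "e x = (f3 x)\<^sup>2 * w (x + h + h + h) / 2 - 3 * f3 x * f1 (x + h + h) * w2 x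
     - 3 * f3 x * f2 (x + h) * w1 x - (f3 x)\<^sup>2 * w x" for x
  \<comment> \<open>Young's inequality with powers of h placed so that each summand integrates to
    order h^6: \<open>f1\<close> is at most A h pointwise, the squared L^2 norm of \<open>w2\<close>
    is of order h^4, and the fourth powers of \<open>f2\<close> and \<open>w1\<close> integrate to
    order h^8 and h^4.\<close>
  define b where "b x = 3 / 2 * A * (f3 x)\<^sup>2 + 3 / 2 * A * ((f3 x)\<^sup>2 + h\<^sup>2 * (w2 x)\<^sup>2)
     + 3 / 2 * ((f3 x)\<^sup>2 + 1 / 2 * (f2 (x + h) ^ 4 / h\<^sup>2 + h\<^sup>2 * w1 x ^ 4))" for x
  have "(Q has_real_derivative q x) (at x)" for x
  proof -
    have "((\<lambda>x. f (x + h + h + h)) has_real_derivative w (x + h + h + h)) (at x)"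
      using f'[of "x + h + h + h"] DERIV_shift[of f _ x "h + h + h"] by (simp add: add.assoc)
    then show ?thesis unfolding Q_def q_def
      by (auto intro!: derivative_eq_intros D3 simp: power2_eq_square algebra_simps)
  qed
  then have "(q has_integral (Q 1 - Q 0)) {0..1}"
    by (intro integral_01_derivative) (simp add: has_real_derivative_iff_has_vector_derivative)
  moreover have "Q 1 = Q 0"
    using p per(1)[THEN periodic_int, of "h + h + h" 1] by (simp add: Q_def periodic_def add_ac) (metis add_0)
  ultimately have q: "(q has_integral 0) {0..1}" by simp
  have eq: "(fdiff h ^^ 3) f x * (fdiff h ^^ 3) (\<lambda>x. - (f x * deriv f x) + \<gamma> * P x) x = q x + e x" for x
  proof -
    have 1: "(fdiff h ^^ 3) f = f3" by (simp add: defs numeral_eq_Suc)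
    have "(fdiff h ^^ 3) (\<lambda>x. - (f x * deriv f x) + \<gamma> * P x) x =
       - (f (x + h + h + h) * w3 x + 3 * f1 (x + h + h) * w2 x + 3 * f2 (x + h) * w1 x + f3 x * w x) + \<gamma> * P3 x"
      unfolding defs w_def[symmetric] by (simp add: numeral_eq_Suc fdiff_def) algebra
    note 2 = this
    show ?thesis unfolding 1 2 q_def e_def by (simp add: power2_eq_square algebra_simps)
  qed
  have ie: "e integrable_on {0..1}"
    unfolding e_def[abs_def] by (intro integrable_continuous_interval continuous_intros c cs) auto
  have ib: "b integrable_on {0..1}"
    unfolding b_def[abs_def] using h by (intro integrable_continuous_interval continuous_intros c cs) auto
  have le: "e x \<le> b x" for x
  proof -
    have Aw: "\<bar>w y\<bar> \<le> A" for y using A by (simp add: w_def)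
    have 1: "(f3 x)\<^sup>2 * w (x + h + h + h) / 2 \<le> 1 / 2 * A * (f3 x)\<^sup>2"
      using mult_left_mono[OF abs_le_D1[OF Aw[of "x + h + h + h"]], of "(f3 x)\<^sup>2"] by (simp add: mult_ac)
    have 2: "- ((f3 x)\<^sup>2 * w x) \<le> A * (f3 x)\<^sup>2"
      using mult_left_mono[OF abs_le_D2[OF Aw[of x]], of "(f3 x)\<^sup>2"] by (simp add: mult_ac)
    have 3: "- (3 * f3 x * f1 (x + h + h) * w2 x) \<le> 3 / 2 * A * ((f3 x)\<^sup>2 + h\<^sup>2 * (w2 x)\<^sup>2)"
    proof -
      have "\<bar>f1 (x + h + h)\<bar> \<le> A * h" unfolding defs by (rule fdiff_le_deriv[OF f' Aw h])
      then have "\<bar>f1 (x + h + h)\<bar> * (\<bar>f3 x\<bar> * \<bar>w2 x\<bar>) \<le> A * h * (\<bar>f3 x\<bar> * \<bar>w2 x\<bar>)"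
        by (intro mult_right_mono) auto
      also have "\<dots> = A * (\<bar>f3 x\<bar> * (h * \<bar>w2 x\<bar>))" by simp
      also have "\<dots> \<le> A * (((f3 x)\<^sup>2 + h\<^sup>2 * (w2 x)\<^sup>2) / 2)"
        using sum_squares_bound[of "\<bar>f3 x\<bar>" "h * \<bar>w2 x\<bar>"] A0
        by (intro mult_left_mono) (auto simp: power_mult_distrib)
      finally have "\<bar>f3 x * f1 (x + h + h) * w2 x\<bar> \<le> A * (((f3 x)\<^sup>2 + h\<^sup>2 * (w2 x)\<^sup>2) / 2)"
        by (simp add: abs_mult mult_ac)
      from abs_le_D2[OF this] show ?thesis unfolding mult.assoc by linarith
    qed
    have 4: "- (3 * f3 x * f2 (x + h) * w1 x) \<le> 3 / 2 * ((f3 x)\<^sup>2 + 1 / 2 * (f2 (x + h) ^ 4 / h\<^sup>2 + h\<^sup>2 * w1 x ^ 4))"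
    proof -
      have "\<bar>f3 x\<bar> * \<bar>f2 (x + h) * w1 x\<bar> \<le> ((f3 x)\<^sup>2 + (f2 (x + h) * w1 x)\<^sup>2) / 2"
        using sum_squares_bound[of "\<bar>f3 x\<bar>" "\<bar>f2 (x + h) * w1 x\<bar>"] by simp
      moreover have "(f2 (x + h) * w1 x)\<^sup>2 = (f2 (x + h))\<^sup>2 / h * (h * (w1 x)\<^sup>2)"
        using h by (simp add: power_mult_distrib)
      moreover have "\<dots> \<le> (((f2 (x + h))\<^sup>2 / h)\<^sup>2 + (h * (w1 x)\<^sup>2)\<^sup>2) / 2"
        using h sum_squares_bound[of "(f2 (x + h))\<^sup>2 / h" "h * (w1 x)\<^sup>2"] by (simp add: mult_ac)
      moreover have "\<dots> = 1 / 2 * (f2 (x + h) ^ 4 / h\<^sup>2 + h\<^sup>2 * w1 x ^ 4)"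
        by (simp add: power_mult_distrib power_divide)
      moreover have "\<bar>f3 x * f2 (x + h) * w1 x\<bar> = \<bar>f3 x\<bar> * \<bar>f2 (x + h) * w1 x\<bar>"
        by (simp add: abs_mult)
      ultimately have "\<bar>f3 x * f2 (x + h) * w1 x\<bar> \<le> ((f3 x)\<^sup>2 + 1 / 2 * (f2 (x + h) ^ 4 / h\<^sup>2 + h\<^sup>2 * w1 x ^ 4)) / 2"
        by argo
      moreover have "- (3 * X) \<le> 3 / 2 * (p + 1 / 2 * Y)" if "\<bar>X\<bar> \<le> (p + 1 / 2 * Y) / 2" for X p Y :: real
        using that by argo
      ultimately show ?thesis unfolding mult.assoc by blast
    qed
    show ?thesis using 1 2 3 4 unfolding e_def b_def by argo
  qed
  have J1: "?I (\<lambda>x. (f3 x)\<^sup>2) \<le> h ^ 6 * N\<^sup>2"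
    using L2_fdiff3_le[OF f, of h] by (simp add: defs N_def numeral_eq_Suc)
  have J2: "?I (\<lambda>x. (w2 x)\<^sup>2) \<le> h ^ 4 * N\<^sup>2"
    using L2_fdiff2_deriv_le[OF f, of h] by (simp add: defs N_def w_def numeral_eq_Suc)
  have J3: "?I (\<lambda>x. f2 (x + h) ^ 4) \<le> h\<^sup>2 * (9 * A\<^sup>2 * (h ^ 6 * N\<^sup>2))"
  proof -
    have "?I (\<lambda>x. f2 (x + h) ^ 4) = ?I (\<lambda>x. f2 x ^ 4)"
      using p by (intro integral_periodic_shift[of "\<lambda>x. f2 x ^ 4"]) (auto intro!: continuous_intros c simp: periodic_def)
    \<comment> \<open>The discrete Gagliardo-Nirenberg inequality is applied to \<open>f1\<close>,
      whose sup bound A h supplies the extra factor h^2 that cancels the division in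
      \<open>b\<close>.\<close>
    also have "\<dots> \<le> 9 * (A * h)\<^sup>2 * ?I (\<lambda>x. (f3 x)\<^sup>2)"
      unfolding defs(2,3) using fdiff_le_deriv[OF f' _ h] A
      by (intro L4_fdiff_le c p) (auto simp: defs(1) w_def)
    also have "\<dots> \<le> 9 * (A * h)\<^sup>2 * (h ^ 6 * N\<^sup>2)" by (intro mult_left_mono J1) auto
    finally show ?thesis by (simp add: power_mult_distrib mult_ac)
  qed
  have J4: "?I (\<lambda>x. w1 x ^ 4) \<le> 9 * A\<^sup>2 * (h ^ 4 * N\<^sup>2)"
  proof -
    have "?I (\<lambda>x. w1 x ^ 4) \<le> 9 * A\<^sup>2 * ?I (\<lambda>x. (w2 x)\<^sup>2)"
      unfolding defs(4,5) using A by (intro L4_fdiff_le c per) (auto simp: w_def)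
    also have "\<dots> \<le> 9 * A\<^sup>2 * (h ^ 4 * N\<^sup>2)" by (intro mult_left_mono J2) auto
    finally show ?thesis .
  qed
  have "?I (\<lambda>x. (fdiff h ^^ 3) f x * (fdiff h ^^ 3) (\<lambda>x. - (f x * deriv f x) + \<gamma> * P x) x) = ?I q + ?I e"
    unfolding eq using q ie by (intro integral_add) auto
  also have "\<dots> = ?I e" using q by (simp add: integral_unique)
  also have "\<dots> \<le> ?I b" by (intro integral_le ie ib le)
  also have "?I b = (3 * A + 3 / 2) * ?I (\<lambda>x. (f3 x)\<^sup>2) + 3 / 2 * A * h\<^sup>2 * ?I (\<lambda>x. (w2 x)\<^sup>2)
     + 3 / 4 / h\<^sup>2 * ?I (\<lambda>x. f2 (x + h) ^ 4) + 3 / 4 * h\<^sup>2 * ?I (\<lambda>x. w1 x ^ 4)"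
  proof -
    have "b = (\<lambda>x. (3 * A + 3 / 2) * (f3 x)\<^sup>2 + 3 / 2 * A * h\<^sup>2 * (w2 x)\<^sup>2
     + 3 / 4 / h\<^sup>2 * (f2 (x + h) ^ 4) + 3 / 4 * h\<^sup>2 * (w1 x ^ 4))"
      unfolding b_def using h by (auto simp: field_simps)
    then show ?thesis
      by (simp only: integral_mult_right[symmetric] integral_add[symmetric] integrable_continuous_interval continuous_intros c cs)
  qed
  also have "\<dots> \<le> (3 * A + 3 / 2) * (h ^ 6 * N\<^sup>2) + 3 / 2 * A * h\<^sup>2 * (h ^ 4 * N\<^sup>2)
     + 3 / 4 / h\<^sup>2 * (h\<^sup>2 * (9 * A\<^sup>2 * (h ^ 6 * N\<^sup>2))) + 3 / 4 * h\<^sup>2 * (9 * A\<^sup>2 * (h ^ 4 * N\<^sup>2))"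
    using A0 by (intro add_mono mult_left_mono J1 J2 J3 J4) auto
  also have "\<dots> = h ^ 6 * N\<^sup>2 * (9 / 2 * A + 3 / 2 + 27 / 2 * A\<^sup>2)"
    using h by (simp add: field_simps power_numeral_reduce)
  finally show ?thesis unfolding N_def .
qed

section \<open>A bound on w up to time T bounds the H^3 norm\<close>

lemma fdiff3_expand:
  "(fdiff h ^^ 3) f x = f (x + h + h + h) - 3 * f (x + h + h) + 3 * f (x + h) - f x"
  by (simp add: numeral_eq_Suc fdiff_def)

text \<open>Sequential compactness: times with unbounded norms would accumulate at some t, but near
  t the difference to u t has norm below 1, so the squared norm is at most 2 + 2 times that of u t.
  This ensures that the supremum in \<open>sobolev_norm_bounded\<close> is finite.\<close>

lemma sobolev_continuous_bounded:
  assumes u: "sobolev_continuous s I u" and K: "compact K" "K \<subseteq> I"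
  obtains B where "\<And>t. t \<in> K \<Longrightarrow> (sobolev_norm s (u t))\<^sup>2 \<le> B"
proof -
  note uS = u[unfolded sobolev_continuous_def]
  have "\<exists>B. \<forall>t\<in>K. (sobolev_norm s (u t))\<^sup>2 \<le> B"
  proof (rule ccontr)
    assume "\<nexists>B. \<forall>t\<in>K. (sobolev_norm s (u t))\<^sup>2 \<le> B"
    then have "\<exists>t\<in>K. (sobolev_norm s (u t))\<^sup>2 > real n" for n by (metis not_le)
    then obtain r where r: "\<And>n. r n \<in> K" "\<And>n. (sobolev_norm s (u (r n)))\<^sup>2 > real n" by metis
    then obtain t \<sigma> where t: "t \<in> K" "strict_mono \<sigma>" "(r \<circ> \<sigma>) \<longlonglongrightarrow> t"
      using K(1)[unfolded compact_def] by metis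
    let ?d = "\<lambda>r. sobolev_norm s (\<lambda>x. u r x - u t x)"
    have "(?d \<longlongrightarrow> ?d t) (at t within I)"
      using uS t(1) K(2) by (auto simp: sobolev_norm_def fourier_coeff_def)
    then have "continuous (at t within I) ?d" by (simp add: continuous_within)
    moreover have "\<forall>n. (r \<circ> \<sigma>) n \<in> I" using r(1) K(2) by auto
    ultimately have "(\<lambda>n. ?d ((r \<circ> \<sigma>) n)) \<longlonglongrightarrow> ?d t"
      using t(3) by (auto simp: continuous_within_sequentially o_def)
    then have "(\<lambda>n. ?d ((r \<circ> \<sigma>) n)) \<longlonglongrightarrow> 0" by (simp add: sobolev_norm_def fourier_coeff_def)
    from order_tendstoD(2)[OF this zero_less_one]
    have "\<forall>\<^sub>F n in sequentially. ?d ((r \<circ> \<sigma>) n) < 1" .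
    moreover have "\<forall>\<^sub>F n in sequentially. 2 + 2 * (sobolev_norm s (u t))\<^sup>2 \<le> real n"
      using filterlim_real_sequentially unfolding filterlim_at_top by blast
    ultimately have "\<forall>\<^sub>F n in sequentially. False"
    proof eventually_elim
      case (elim n)
      let ?r = "r (\<sigma> n)"
      have S: "u ?r \<in> sobolev s" "u t \<in> sobolev s" using uS r(1) t(1) K(2) by auto
      have "(sobolev_norm s (\<lambda>x. 1 * (u ?r x - u t x) + 1 * u t x))\<^sup>2 \<le>
         2 * 1\<^sup>2 * (?d ?r)\<^sup>2 + 2 * 1\<^sup>2 * (sobolev_norm s (u t))\<^sup>2"
        by (rule sobolev_lincomb(2)[OF sobolev_diff[OF S] S(2)])
      moreover have "(?d ?r)\<^sup>2 \<le> 1"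
        using elim(1) sobolev_norm_nonneg[of s] by (simp add: power_le_one)
      moreover have "real n \<le> real (\<sigma> n)" using seq_suble[OF t(2)] by simp
      ultimately show False using elim(2) r(2)[of "\<sigma> n"] by simp
    qed
    then show False by simp
  qed
  then show ?thesis using that by blast
qed

context classical_solution
begin

lemma deriv_u: "t \<in> {0<..<T} \<Longrightarrow> deriv (u t) = w t"
  using u_x by (auto intro!: DERIV_imp_deriv)

text \<open>A third difference is a finite combination of values of u, so differentiation under the
  integral requires only that u_t exist pointwise and be jointly continuous.\<close>

lemma energy_derivative:
  assumes t: "t \<in> {0<..<T}"
  shows "((\<lambda>s. integral {0..1} (\<lambda>x. ((fdiff h ^^ 3) (u s) x)\<^sup>2)) has_real_derivative
    integral {0..1} (\<lambda>x. 2 * ((fdiff h ^^ 3) (u t) x * (fdiff h ^^ 3) (v t) x))) (at t)"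
proof -
  have c: "continuous_on ({0<..<T} \<times> {0..1}) (\<lambda>p. (fdiff h ^^ 3) (u (fst p)) (snd p))"
    "continuous_on ({0<..<T} \<times> {0..1}) (\<lambda>p. (fdiff h ^^ 3) (v (fst p)) (snd p))"
    unfolding fdiff3_expand
    by (intro continuous_intros continuous_on_joint_compose[OF u_continuous] continuous_on_joint_compose[OF v_continuous]; auto)+
  have cx: "continuous_on {0..1} (\<lambda>x. (fdiff h ^^ 3) (u s) x)" if "s \<in> {0<..<T}" for s
    unfolding fdiff3_expand
    by (intro continuous_intros continuous_on_joint_compose[OF u_continuous]; use that in auto)
  have "((\<lambda>s. integral (cbox 0 1) (\<lambda>x. ((fdiff h ^^ 3) (u s) x)\<^sup>2)) has_field_derivative
    integral (cbox 0 1) (\<lambda>x. 2 * ((fdiff h ^^ 3) (u t) x * (fdiff h ^^ 3) (v t) x))) (at t within {0<..<T})"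
  proof (rule leibniz_rule_field_derivative)
    fix s x :: real assume s: "s \<in> {0<..<T}"
    have "((\<lambda>s. (fdiff h ^^ 3) (u s) x) has_real_derivative (fdiff h ^^ 3) (v s) x) (at s)"
      unfolding fdiff3_expand by (auto intro!: derivative_eq_intros u_t[OF s])
    from has_field_derivative_at_within[OF DERIV_power[OF this, of 2]]
    show "((\<lambda>s. ((fdiff h ^^ 3) (u s) x)\<^sup>2) has_field_derivative
        2 * ((fdiff h ^^ 3) (u s) x * (fdiff h ^^ 3) (v s) x)) (at s within {0<..<T})"
      by (simp add: mult_ac)
  next
    show "(\<lambda>x. ((fdiff h ^^ 3) (u s) x)\<^sup>2) integrable_on cbox 0 1" if "s \<in> {0<..<T}" for s
      using cx[OF that] by (auto intro!: integrable_continuous_interval continuous_intros)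
    show "continuous_on ({0<..<T} \<times> cbox 0 1) (\<lambda>(s, x). 2 * ((fdiff h ^^ 3) (u s) x * (fdiff h ^^ 3) (v s) x))"
      using c by (auto simp: case_prod_unfold intro!: continuous_intros)
  qed (use t in auto)
  then show ?thesis using t by (simp add: at_within_open[OF t])
qed

text \<open>For each h the mean value theorem bounds the growth of the h-energy. Its derivative is
  controlled by the full H^3 norm, not by the energy at the same h, so a bound S over the whole
  interval enters. The factor 8 is the price of returning from differences to the norm.\<close>

lemma sobolev_norm_increment:
  assumes H3: "\<And>t. t \<in> {0<..<T} \<Longrightarrow> u t \<in> sobolev 3"
    and st: "0 < s" "s \<le> t" "t < T"
    and A: "\<And>r x. r \<in> {s..t} \<Longrightarrow> \<bar>w r x\<bar> \<le> A"
    and S: "\<And>r. r \<in> {s..t} \<Longrightarrow> (sobolev_norm 3 (u r))\<^sup>2 \<le> S"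
  shows "(sobolev_norm 3 (u t))\<^sup>2 \<le>
    8 * ((sobolev_norm 3 (u s))\<^sup>2 + (t - s) * ((9 * A + 3 + 27 * A\<^sup>2) * S))"
proof (rule sobolev_norm_le_fdiff3)
  have I: "r \<in> {0<..<T}" if "r \<in> {s..t}" for r using that st by auto
  have tI: "t \<in> {0<..<T}" and sI: "s \<in> {0<..<T}" using st by auto
  show "u t \<in> sobolev 3" by (rule H3[OF tI])
  \<comment> \<open>Differences do not see the mean; it vanishes because u t is the derivative of a
    periodic function.\<close>
  show "fourier_coeff (u t) 0 = 0"
  proof -
    obtain P where "periodic P" "\<And>x. (P has_real_derivative u t x) (at x)"
      using antiderivative[OF tI] by blast
    then show ?thesis using fourier_coeff_deriv[of P "u t" 0] u_slice[OF tI] by simp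
  qed
  have A0: "A \<ge> 0" using A[of s 0] st by auto
  fix h :: real assume h: "h > 0"
  define E where "E r = integral {0..1} (\<lambda>x. ((fdiff h ^^ 3) (u r) x)\<^sup>2)" for r
  define E' where "E' r = integral {0..1} (\<lambda>x. 2 * ((fdiff h ^^ 3) (u r) x * (fdiff h ^^ 3) (v r) x))" for r
  have E': "(E has_real_derivative E' r) (at r)" if "r \<in> {s..t}" for r
    unfolding E_def[abs_def] E'_def by (rule energy_derivative[OF I[OF that]])
  have le: "E' r \<le> h ^ 6 * ((9 * A + 3 + 27 * A\<^sup>2) * S)" if r: "r \<in> {s..t}" for r
  proof -
    note rI = I[OF r]
    obtain P where P: "periodic P" "\<And>x. (P has_real_derivative u r x) (at x)"
      "\<And>x. v r x = - (u r x * w r x) + \<gamma> * P x"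
      using antiderivative[OF rI] by blast
    have v: "v r = (\<lambda>x. - (u r x * deriv (u r) x) + \<gamma> * P x)" using P(3) deriv_u[OF rI] by auto
    have "E' r = 2 * integral {0..1} (\<lambda>x. (fdiff h ^^ 3) (u r) x * (fdiff h ^^ 3) (v r) x)"
      by (simp add: E'_def)
    also have "\<dots> \<le> 2 * (h ^ 6 * (sobolev_norm 3 (u r))\<^sup>2 * (9 / 2 * A + 3 / 2 + 27 / 2 * A\<^sup>2))"
      unfolding v using A[OF r] deriv_u[OF rI]
      by (intro mult_left_mono energy_estimate[OF H3[OF rI] _ h P(2,1)]) auto
    also have "\<dots> = h ^ 6 * ((9 * A + 3 + 27 * A\<^sup>2) * (sobolev_norm 3 (u r))\<^sup>2)"
      by (simp add: algebra_simps)
    also have "\<dots> \<le> h ^ 6 * ((9 * A + 3 + 27 * A\<^sup>2) * S)"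
      using A0 h by (intro mult_left_mono S[OF r]) auto
    finally show ?thesis .
  qed
  have "E t \<le> E s + (t - s) * (h ^ 6 * ((9 * A + 3 + 27 * A\<^sup>2) * S))"
  proof (cases "s = t")
    case False
    then have "s < t" using st by simp
    from MVT2[OF this E'] obtain z where z: "s < z" "z < t" "E t - E s = (t - s) * E' z" by auto
    then have "E t - E s \<le> (t - s) * (h ^ 6 * ((9 * A + 3 + 27 * A\<^sup>2) * S))"
      using le[of z] st by (simp add: mult_left_mono)
    then show ?thesis by simp
  qed simp
  moreover have "E s \<le> h ^ 6 * (sobolev_norm 3 (u s))\<^sup>2"
    unfolding E_def by (rule L2_fdiff3_le[OF H3[OF sI]])
  ultimately show "integral {0..1} (\<lambda>x. ((fdiff h ^^ 3) (u t) x)\<^sup>2) \<le>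
      h ^ 6 * ((sobolev_norm 3 (u s))\<^sup>2 + (t - s) * ((9 * A + 3 + 27 * A\<^sup>2) * S))"
    unfolding E_def by (simp add: algebra_simps)
qed

lemma sobolev_norm_bounded:
  assumes H3: "sobolev_continuous 3 {0<..<T} u" and a: "a \<in> {0<..<T}"
    and A: "\<And>t x. t \<in> {a..<T} \<Longrightarrow> \<bar>w t x\<bar> \<le> A"
  obtains s K where "s < T" "\<And>t. t \<in> {s..<T} \<Longrightarrow> (sobolev_norm 3 (u t))\<^sup>2 \<le> K"
proof -
  have A0: "A \<ge> 0" using A[of a 0] a by auto
  define C where "C = 9 * A + 3 + 27 * A\<^sup>2"
  have C: "C > 0" using A0 zero_le_power2[of A] unfolding C_def by linarith
  \<comment> \<open>On a final interval of length at most 1 / (16 C) the increment 8 (t - s) C S is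
    at most S / 2 and can be absorbed. The resulting factor 16 is the same for all later times,
    hence bounds the norm up to T.\<close>
  define s where "s = max a (T - 1 / (16 * C))"
  have s: "s \<in> {a..<T}" "T - s \<le> 1 / (16 * C)" using a C by (auto simp: s_def)
  have uS: "u t \<in> sobolev 3" if "t \<in> {0<..<T}" for t using H3 that by (auto simp: sobolev_continuous_def)
  have "(sobolev_norm 3 (u b))\<^sup>2 \<le> 16 * (sobolev_norm 3 (u s))\<^sup>2" if b: "b \<in> {s..<T}" for b
  proof -
    let ?n = "\<lambda>t. (sobolev_norm 3 (u t))\<^sup>2"
    have "{s..b} \<subseteq> {0<..<T}" using a s b by auto
    then obtain B where "\<And>t. t \<in> {s..b} \<Longrightarrow> ?n t \<le> B"
      using sobolev_continuous_bounded[OF H3 compact_Icc] by blast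
    then have bdd: "bdd_above (?n ` {s..b})" by (rule bdd_aboveI2)
    define S where "S = (SUP t\<in>{s..b}. ?n t)"
    have nS: "?n t \<le> S" if "t \<in> {s..b}" for t
      unfolding S_def by (rule cSUP_upper[OF that bdd])
    have "?n t \<le> 8 * ?n s + S / 2" if t: "t \<in> {s..b}" for t
    proof -
      have "?n t \<le> 8 * (?n s + (t - s) * (C * S))"
        unfolding C_def by (rule sobolev_norm_increment[OF uS]) (use a s b t A nS in auto)
      moreover have "S \<ge> 0" using nS[of s] b by (auto intro: order_trans[OF zero_le_power2])
      then have "(t - s) * (C * S) \<le> 1 / (16 * C) * (C * S)"
        using s b t C by (intro mult_right_mono) auto
      ultimately show ?thesis using C by simp
    qed
    then have "S \<le> 8 * ?n s + S / 2" unfolding S_def using b by (intro cSUP_least) auto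
    then show ?thesis using nS[of b] b by auto
  qed
  then show ?thesis using that[of s] s by auto
qed

end

section \<open>Blow-up rates\<close>

context classical_solution
begin

lemma w_bounded_on_compact:
  assumes "0 < a" "b < T"
  obtains M where "M > 0" "\<And>t x. t \<in> {a..b} \<Longrightarrow> \<bar>w t x\<bar> \<le> M"
proof -
  have "bounded ((\<lambda>(t, x). w t x) ` ({a..b} \<times> {0..1}))"
    using assms by (intro compact_imp_bounded compact_continuous_image continuous_on_subset[OF w_continuous] compact_Times) auto
  then obtain M where M: "M > 0" "\<And>p. p \<in> {a..b} \<times> {0..1} \<Longrightarrow> \<bar>(\<lambda>(t, x). w t x) p\<bar> \<le> M"
    unfolding bounded_pos by (metis (no_types, lifting) image_eqI real_norm_def)
  have "\<bar>w t x\<bar> \<le> M" if t: "t \<in> {a..b}" for t x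
  proof -
    have "t \<in> {0<..<T}" using t assms by auto
    then show ?thesis
      using M(2)[of "(t, frac x)"] t periodic_frac[OF w_periodic, of t x] frac_lt_1[of x] frac_ge_0[of x]
      by (simp add: less_imp_le)
  qed
  then show ?thesis using that M(1) by blast
qed

lemma deriv_reciprocal: "t < \<tau> \<Longrightarrow> ((\<lambda>t. - c / (\<tau> - t)) has_real_derivative - c / (\<tau> - t)\<^sup>2) (at t)"
  by (auto intro!: derivative_eq_intros simp: power2_eq_square)

lemma inf_rate_lower:
  assumes \<delta>: "0 < \<delta>" "\<delta> < 1" and t: "0 < t" "t < T"
    and B: "\<And>s x. s \<in> {t..<T} \<Longrightarrow> \<bar>u s x\<bar> \<le> B" "B > 0"
    and small: "\<gamma> * B * (2 * (T - t))\<^sup>2 < \<delta> * (1 - \<delta>)"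
  shows "- (1 + \<delta>) / (1 - \<delta>) < (T - t) * w t x"
proof -
  \<comment> \<open>Stopping short of T keeps w bounded on [t, \<tau>], while the barrier tends to
    minus infinity at \<tau>.\<close>
  define \<tau> where "\<tau> = T - \<delta> * (T - t)"
  have "\<delta> * (T - t) < 1 * (T - t)" using \<delta> t by (intro mult_strict_right_mono) auto
  then have \<tau>: "t < \<tau>" "\<tau> < T" "\<tau> - t = (1 - \<delta>) * (T - t)" using \<delta> t by (auto simp: \<tau>_def algebra_simps)
  obtain M where M: "M > 0" "\<And>s x. s \<in> {t..\<tau>} \<Longrightarrow> \<bar>w s x\<bar> \<le> M"
    using w_bounded_on_compact[OF t(1) \<tau>(2)] by blast
  \<comment> \<open>At time \<tau> - d the barrier equals - (1 + \<delta>) / d, which is at most -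
    (M + 1) and hence below w; the other bound keeps this time at or after t.\<close>
  define d where "d = min (\<tau> - t) ((1 + \<delta>) / (M + 1))"
  have d: "0 < d" "d \<le> \<tau> - t" "d \<le> (1 + \<delta>) / (M + 1)" using \<tau> \<delta> M by (auto simp: d_def)
  have "d * (M + 1) \<le> 1 + \<delta>" using d(3) M(1) by (simp add: pos_le_divide_eq)
  then have Md: "M + 1 \<le> (1 + \<delta>) / d" using d(1) by (simp add: pos_le_divide_eq mult.commute)
  let ?\<psi> = "\<lambda>s. - (1 + \<delta>) / (\<tau> - s)"
  have "?\<psi> t < w t x"
  proof (rule backward_barrier[where b = "\<tau> - d" and B = B])
    show "0 < t" "t \<le> \<tau> - d" "\<tau> - d < T" using t d \<tau> by auto
    show "\<bar>u s y\<bar> \<le> B" if "s \<in> {t..\<tau> - d}" for s y using B(1)[of s y] that d \<tau> by auto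
    show "(?\<psi> has_real_derivative - (1 + \<delta>) / (\<tau> - s)\<^sup>2) (at s)" if "s \<in> {t..\<tau> - d}" for s
      using that d by (intro deriv_reciprocal) auto
    show "- (1 + \<delta>) / (\<tau> - s)\<^sup>2 > - (?\<psi> s)\<^sup>2 + \<gamma> * B" if s: "s \<in> {t..\<tau> - d}" for s
    proof -
      have pos: "0 < \<tau> - s" and le: "\<tau> - s \<le> 2 * (T - t)" using s d \<tau> t by auto
      have "\<gamma> * B * (\<tau> - s)\<^sup>2 \<le> \<gamma> * B * (2 * (T - t))\<^sup>2"
        using pos le gamma_pos B(2) by (intro mult_left_mono power_mono) auto
      also have "\<dots> < \<delta> * (1 - \<delta>)" by (rule small)
      \<comment> \<open>The supersolution condition asks for c^2 - c = \<delta> (1 + \<delta>). The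
        smaller \<delta> (1 - \<delta>) is the value c - c^2 for c = 1 - \<delta>, so one smallness
        hypothesis serves both rate bounds.\<close>
      also have "\<dots> \<le> (1 + \<delta>)\<^sup>2 - (1 + \<delta>)" using \<delta> by (simp add: power2_eq_square algebra_simps)
      finally have "\<gamma> * B < ((1 + \<delta>)\<^sup>2 - (1 + \<delta>)) / (\<tau> - s)\<^sup>2" using pos by (simp add: pos_less_divide_eq)
      then show ?thesis
        unfolding power_divide power2_minus minus_divide_left[symmetric] diff_divide_distrib[of "(1 + \<delta>)\<^sup>2" "1 + \<delta>"] by linarith
    qed
    show "?\<psi> (\<tau> - d) < w (\<tau> - d) y" for y
    proof -
      have "- M \<le> w (\<tau> - d) y" using M(2)[of "\<tau> - d" y] d by (simp add: abs_le_iff)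
      moreover have "\<tau> - (\<tau> - d) = d" by simp
      ultimately show ?thesis using Md unfolding minus_divide_left[symmetric] by simp
    qed
  qed
  then have "(T - t) * ?\<psi> t < (T - t) * w t x" using t by (intro mult_strict_left_mono) auto
  moreover have "(T - t) * ?\<psi> t = - (1 + \<delta>) / (1 - \<delta>)" using t \<tau>(3) \<delta> by simp
  ultimately show ?thesis by simp
qed

lemma inf_rate_upper:
  assumes H3: "sobolev_continuous 3 {0<..<T} u"
    and blow_up: "filterlim (\<lambda>t. sobolev_norm 3 (u t)) at_top (at_left T)"
    and \<delta>: "0 < \<delta>" "\<delta> < 1" and t: "0 < t" "t < T"
    and B: "\<And>s x. s \<in> {t..<T} \<Longrightarrow> \<bar>u s x\<bar> \<le> B" "B > 0"
    and small: "\<gamma> * B * (2 * (T - t))\<^sup>2 < \<delta> * (1 - \<delta>)"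
  shows "\<exists>x. (T - t) * w t x \<le> - (1 - \<delta>) / (1 + \<delta>)"
proof (rule ccontr)
  assume "\<nexists>x. (T - t) * w t x \<le> - (1 - \<delta>) / (1 + \<delta>)"
  then have w0: "- (1 - \<delta>) / (1 + \<delta>) < (T - t) * w t x" for x by (auto simp: not_le)
  \<comment> \<open>The pole lies beyond T, so the barrier stays finite up to time T. Its distance
    (1 + \<delta>) (T - t) from t explains the factor 2 in the hypothesis
    \<open>small\<close>.\<close>
  define \<tau> where "\<tau> = T + \<delta> * (T - t)"
  have "\<delta> * (T - t) \<le> 1 * (T - t)" using \<delta> t by (intro mult_right_mono) auto
  then have \<tau>: "T < \<tau>" "\<tau> - t \<le> 2 * (T - t)" "\<tau> - t = (1 + \<delta>) * (T - t)"
    using \<delta> t by (auto simp: \<tau>_def algebra_simps)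
  let ?\<phi> = "\<lambda>s. - (1 - \<delta>) / (\<tau> - s)"
  have lower: "?\<phi> s < w s x" if s: "s \<in> {t..<T}" for s x
  proof (rule lower_barrier[where a = t and b = s and B = B])
    show "0 < t" "t \<le> s" "s < T" "s \<in> {t..s}" using t s by auto
    show "\<bar>u r y\<bar> \<le> B" if "r \<in> {t..s}" for r y using B(1)[of r y] that s by auto
    show "(?\<phi> has_real_derivative - (1 - \<delta>) / (\<tau> - r)\<^sup>2) (at r)" if "r \<in> {t..s}" for r
      using that s \<tau> by (intro deriv_reciprocal) auto
    show "- (1 - \<delta>) / (\<tau> - r)\<^sup>2 < - (?\<phi> r)\<^sup>2 - \<gamma> * B" if r: "r \<in> {t..s}" for r
    proof -
      have pos: "0 < \<tau> - r" and le: "\<tau> - r \<le> 2 * (T - t)" using r s \<tau> by auto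
      have "\<gamma> * B * (\<tau> - r)\<^sup>2 \<le> \<gamma> * B * (2 * (T - t))\<^sup>2"
        using pos le gamma_pos B(2) by (intro mult_left_mono power_mono) auto
      also have "\<dots> < \<delta> * (1 - \<delta>)" by (rule small)
      also have "\<dots> = (1 - \<delta>) - (1 - \<delta>)\<^sup>2" by (simp add: power2_eq_square algebra_simps)
      finally have "\<gamma> * B < ((1 - \<delta>) - (1 - \<delta>)\<^sup>2) / (\<tau> - r)\<^sup>2" using pos by (simp add: pos_less_divide_eq)
      then show ?thesis
        unfolding power_divide power2_minus minus_divide_left[symmetric] diff_divide_distrib[of "1 - \<delta>" "(1 - \<delta>)\<^sup>2"] by linarith
    qed
    show "?\<phi> t < w t y" for y
    proof -
      have "(T - t) * ?\<phi> t = - (1 - \<delta>) / (1 + \<delta>)" using t \<tau>(3) \<delta> by simp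
      then have "(T - t) * ?\<phi> t < (T - t) * w t y" using w0[of y] by simp
      then show ?thesis using t by (simp only: mult_less_cancel_left_pos diff_gt_0_iff_gt)
    qed
  qed
  have tI: "t \<in> {0<..<T}" using t by simp
  obtain C where C: "\<And>s x. s \<in> {t..<T} \<Longrightarrow> w s x \<le> C" using w_bounded_above[OF tI] by blast
  \<comment> \<open>The second entry is the size at time T of the barrier, which decreases in time
    and so bounds w from below on all of [t, T).\<close>
  define A where "A = max C ((1 - \<delta>) / (\<tau> - T))"
  have "\<bar>w s x\<bar> \<le> A" if s: "s \<in> {t..<T}" for s x
  proof -
    have "(1 - \<delta>) / (\<tau> - s) \<le> (1 - \<delta>) / (\<tau> - T)"
      using s \<tau> \<delta> by (intro divide_left_mono) auto
    also have "\<dots> \<le> A" by (simp add: A_def)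
    finally have "- A \<le> w s x"
      using lower[OF s, of x] unfolding minus_divide_left[symmetric] by linarith
    then show ?thesis using C[OF s, of x] by (simp add: A_def abs_le_iff)
  qed
  from sobolev_norm_bounded[OF H3 tI this] obtain s K where
    sK: "s < T" "\<And>t. t \<in> {s..<T} \<Longrightarrow> (sobolev_norm 3 (u t))\<^sup>2 \<le> K" by blast
  \<comment> \<open>K bounds the square of the norm. A norm of at least K + 2 exceeds 1, hence is at
    most its own square and so at most K: a contradiction.\<close>
  have "\<forall>\<^sub>F t in at_left T. sobolev_norm 3 (u t) \<ge> K + 2"
    using blow_up unfolding filterlim_at_top by blast
  moreover have "\<forall>\<^sub>F t in at_left T. t \<in> {s..<T}"
    using eventually_at_left_real[OF sK(1)] by (rule eventually_mono) auto
  moreover have "\<forall>\<^sub>F t in at_left T. t < T" by (simp add: eventually_at_filter)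
  ultimately have "\<forall>\<^sub>F t in at_left T. False"
  proof eventually_elim
    case (elim t)
    have "K \<ge> 0" using sK(2)[OF elim(2)] zero_le_power2 order_trans by blast
    then have "sobolev_norm 3 (u t) * 1 \<le> sobolev_norm 3 (u t) * sobolev_norm 3 (u t)"
      using elim(1) by (intro mult_left_mono) auto
    then show False using sK(2)[OF elim(2)] elim(1) by (simp add: power2_eq_square)
  qed
  then show False by simp
qed

text \<open>Rolle's theorem over one period; it makes the spatial supremum of w nonnegative, which
  is the lower half of \<open>sup_rate\<close>.\<close>

lemma exists_w_zero:
  assumes t: "t \<in> {0<..<T}"
  shows "\<exists>x. w t x = 0"
proof -
  obtain z where "u t 1 - u t 0 = (1 - 0) * w t z"
    using MVT2[of 0 1 "u t" "w t"] u_x[OF t] by auto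
  moreover have "u t 1 = u t 0" using u_periodic[OF t] unfolding periodic_def by (metis add_0)
  ultimately show ?thesis by auto
qed

lemma sup_rate: "((\<lambda>t. (T - t) * (SUP x. w t x)) \<longlongrightarrow> 0) (at_left T)"
proof -
  have a: "T / 2 \<in> {0<..<T}" using T_pos by simp
  obtain C where C: "\<And>s x. s \<in> {T / 2..<T} \<Longrightarrow> w s x \<le> C" using w_bounded_above[OF a] by blast
  have ev: "\<forall>\<^sub>F t in at_left T. t \<in> {T / 2<..<T}" using eventually_at_left_real[of "T / 2" T] T_pos by simp
  have b: "0 \<le> (SUP x. w t x) \<and> (SUP x. w t x) \<le> C" if t: "t \<in> {T / 2<..<T}" for t
  proof
    have le: "w t x \<le> C" for x using C[of t x] t by simp
    obtain x where "w t x = 0" using exists_w_zero[of t] t T_pos by auto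
    moreover have "w t x \<le> (SUP x. w t x)" by (rule cSUP_upper[OF UNIV_I bdd_aboveI2[OF le]])
    ultimately show "0 \<le> (SUP x. w t x)" by simp
    show "(SUP x. w t x) \<le> C" using le by (intro cSUP_least) auto
  qed
  show ?thesis
  proof (rule tendsto_sandwich[OF _ _ tendsto_const])
    show "\<forall>\<^sub>F t in at_left T. 0 \<le> (T - t) * (SUP x. w t x)"
      using ev by eventually_elim (use b in auto)
    show "\<forall>\<^sub>F t in at_left T. (T - t) * (SUP x. w t x) \<le> (T - t) * C"
      using ev by eventually_elim (use b in \<open>auto intro!: mult_left_mono\<close>)
    show "((\<lambda>t. (T - t) * C) \<longlongrightarrow> 0) (at_left T)"
      by (auto intro!: tendsto_eq_intros)
  qed
qed

lemma inf_rate: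
  assumes H3: "sobolev_continuous 3 {0<..<T} u"
    and blow_up: "filterlim (\<lambda>t. sobolev_norm 3 (u t)) at_top (at_left T)"
  shows "((\<lambda>t. (T - t) * (INF x. w t x)) \<longlongrightarrow> - 1) (at_left T)"
proof (rule tendstoI)
  fix e :: real assume e: "e > 0"
  \<comment> \<open>With \<delta> \<le> 1/4 the ratios (1 + \<delta>) / (1 - \<delta>) and (1 -
    \<delta>) / (1 + \<delta>) lie strictly within 4 \<delta> \<le> e of 1.\<close>
  define \<delta> where "\<delta> = min e 1 / 4"
  have \<delta>: "0 < \<delta>" "\<delta> < 1" "4 * \<delta> \<le> e" using e by (auto simp: \<delta>_def)
  have "(1 + \<delta>) < (1 + 4 * \<delta>) * (1 - \<delta>)" "(1 - 4 * \<delta>) * (1 + \<delta>) < 1 - \<delta>"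
  proof -
    have eq: "(1 + 4 * \<delta>) * (1 - \<delta>) = 1 + 3 * \<delta> - 4 * (\<delta> * \<delta>)"
      "(1 - 4 * \<delta>) * (1 + \<delta>) = 1 - 3 * \<delta> - 4 * (\<delta> * \<delta>)"
      by (simp_all add: algebra_simps)
    have "\<delta> \<le> 1 / 4" by (simp add: \<delta>_def)
    then have "\<delta> * \<delta> > 0" "\<delta> * \<delta> \<le> \<delta> * (1 / 4)" using \<delta> by (auto intro!: mult_left_mono simp del: mult_le_cancel_left_pos)
    then show "(1 + \<delta>) < (1 + 4 * \<delta>) * (1 - \<delta>)" "(1 - 4 * \<delta>) * (1 + \<delta>) < 1 - \<delta>"
      using \<delta> unfolding eq by linarith+
  qed
  moreover have "(1 + 4 * \<delta>) * (1 - \<delta>) \<le> (1 + e) * (1 - \<delta>)" "(1 - e) * (1 + \<delta>) \<le> (1 - 4 * \<delta>) * (1 + \<delta>)"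
    using \<delta> by (intro mult_right_mono; simp)+
  ultimately have "1 + \<delta> < (1 + e) * (1 - \<delta>)" "(1 - e) * (1 + \<delta>) < 1 - \<delta>" by linarith+
  then have \<delta>2: "(1 + \<delta>) / (1 - \<delta>) < 1 + e" "1 - e < (1 - \<delta>) / (1 + \<delta>)"
    using \<delta> by (simp_all add: pos_divide_less_eq pos_less_divide_eq)
  have a: "T / 2 \<in> {0<..<T}" using T_pos by simp
  obtain B where B: "B > 0" "\<And>s x. s \<in> {T / 2..<T} \<Longrightarrow> \<bar>u s x\<bar> \<le> B" using u_bounded[OF a] by blast
  have "((\<lambda>t. \<gamma> * B * (2 * (T - t))\<^sup>2) \<longlongrightarrow> \<gamma> * B * (2 * (T - T))\<^sup>2) (at_left T)"
    by (intro tendsto_intros)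
  from order_tendstoD(2)[OF this, of "\<delta> * (1 - \<delta>)"] \<delta>
  have "\<forall>\<^sub>F t in at_left T. \<gamma> * B * (2 * (T - t))\<^sup>2 < \<delta> * (1 - \<delta>)" by simp
  moreover have "\<forall>\<^sub>F t in at_left T. t \<in> {T / 2<..<T}" using eventually_at_left_real[of "T / 2" T] T_pos by simp
  ultimately show "\<forall>\<^sub>F t in at_left T. dist ((T - t) * (INF x. w t x)) (- 1) < e"
  proof eventually_elim
    case (elim t)
    then have t: "0 < t" "t < T" and Bt: "\<And>s x. s \<in> {t..<T} \<Longrightarrow> \<bar>u s x\<bar> \<le> B"
      using T_pos B(2) by auto
    define k where "k = - (1 + \<delta>) / (1 - \<delta>)"
    define c where "c = k / (T - t)"
    have lower: "c \<le> w t x" for x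
      using inf_rate_lower[OF \<delta>(1,2) t Bt B(1) elim(1), of x, folded k_def] t
      unfolding c_def by (simp add: pos_divide_le_eq mult.commute)
    then have "c \<le> (INF x. w t x)" by (intro cINF_greatest) auto
    then have "k \<le> (T - t) * (INF x. w t x)"
      using t unfolding c_def by (simp add: pos_divide_le_eq mult.commute)
    then have 1: "- (1 + \<delta>) / (1 - \<delta>) \<le> (T - t) * (INF x. w t x)" unfolding k_def .
    obtain x where x: "(T - t) * w t x \<le> - (1 - \<delta>) / (1 + \<delta>)"
      using inf_rate_upper[OF H3 blow_up \<delta>(1,2) t Bt B(1) elim(1)] by blast
    have "(INF x. w t x) \<le> w t x" using lower by (intro cINF_lower bdd_belowI2) auto
    then have "(T - t) * (INF x. w t x) \<le> (T - t) * w t x" using t by (intro mult_left_mono) auto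
    then have 2: "(T - t) * (INF x. w t x) \<le> - (1 - \<delta>) / (1 + \<delta>)" using x by linarith
    show ?case using 1 2 \<delta>2 unfolding dist_real_def abs_less_iff minus_divide_left[symmetric] by linarith
  qed
qed

end

section \<open>From the Sobolev formulation to a classical solution\<close>

lemma sobolev_continuous_subset:
  assumes "sobolev_continuous s I u" "J \<subseteq> I"
  shows "sobolev_continuous s J u"
  using assms unfolding sobolev_continuous_def by (blast intro: tendsto_within_subset)

text \<open>G minus its mean is the average over z of G x - G z. Once x is reduced to the
  fundamental domain, points there are at distance at most 1, so each difference is at most
  B.\<close>

lemma mean_zero_antiderivative_bound:
  fixes G :: "real \<Rightarrow> real"
  assumes G: "\<And>x. (G has_real_derivative g x) (at x)" "periodic G" and B: "\<And>x. \<bar>g x\<bar> \<le> B"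
  shows "\<bar>G x - integral {0..1} G\<bar> \<le> B"
proof -
  define y where "y = frac x"
  have y: "y \<in> {0..1}" using frac_lt_1[of x] frac_ge_0[of x] by (simp add: y_def less_imp_le)
  have cG: "continuous_on {0..1} G"
    by (rule DERIV_continuous_on[OF has_field_derivative_at_within[OF G(1)]])
  have B0: "B \<ge> 0" using B[of 0] by linarith
  have "\<bar>G y - G z\<bar> \<le> B" if z: "z \<in> {0..1}" for z
  proof -
    have "norm (G y - G z) \<le> B * norm (y - z)"
      using B by (intro field_differentiable_bound[of UNIV G g]) (auto intro: G(1))
    also have "\<dots> \<le> B * 1" using y z B0 by (intro mult_left_mono) auto
    finally show ?thesis by simp
  qed
  then have "norm (integral {0..1} (\<lambda>z. G y - G z)) \<le> integral {0..1} (\<lambda>z::real. B)"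
    by (intro Henstock_Kurzweil_Integration.integral_norm_bound_integral integrable_continuous_interval continuous_intros cG) auto
  moreover have "integral {0..1} (\<lambda>z. G y - G z) = G y - integral {0..1} G"
    by (subst integral_diff) (auto intro!: integrable_continuous_interval cG)
  ultimately show ?thesis using periodic_frac[OF G(2), of x] by (simp add: y_def)
qed

lemma ostrovsky_hunter_classical:
  assumes "\<gamma> > 0" "T > 0" and sol: "ostrovsky_hunter_solution \<gamma> u0 T u"
  obtains v where "classical_solution \<gamma> T u (\<lambda>t. deriv (u t)) v"
proof -
  have cont3: "sobolev_continuous (Suc (Suc (Suc 0))) {0..<T} u"
    using sol by (simp add: ostrovsky_hunter_solution_def numeral_eq_Suc)
  obtain v where cont2: "sobolev_continuous (Suc (Suc 0)) {0..<T} v"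
    and D: "sobolev_has_derivative (Suc (Suc 0)) {0..<T} u v"
    and eq: "\<And>t x. t \<in> {0<..<T} \<Longrightarrow> x \<in> {0..1} \<Longrightarrow>
      v t x + u t x * deriv (u t) x = \<gamma> * antideriv (u t) x"
    using sol by (auto simp: ostrovsky_hunter_solution_def numeral_eq_Suc)
  let ?I = "{0<..<T}"
  have sub: "?I \<subseteq> {0..<T}" by auto
  have u3: "u t \<in> sobolev (Suc (Suc (Suc 0)))" and v2: "v t \<in> sobolev (Suc (Suc 0))" if "t \<in> ?I" for t
    using cont3 cont2 that by (auto simp: sobolev_continuous_def)
  have at: "at t within {0..<T} = at t" if "t \<in> ?I" for t
    using that by (intro at_within_nhd[of t ?I]) auto
  note u_per = sobolevD(2)[OF u3] and v_per = sobolevD(2)[OF v2]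
    and w_per = sobolevD(2)[OF sobolev_deriv(2)[OF u3]]
  have P: "\<exists>P. periodic P \<and> (\<forall>x. (P has_real_derivative u t x) (at x)) \<and>
      (\<forall>x. v t x = - (u t x * deriv (u t) x) + \<gamma> * P x) \<and>
      (\<forall>B. (\<forall>x. \<bar>u t x\<bar> \<le> B) \<longrightarrow> (\<forall>x. \<bar>P x\<bar> \<le> B))" if t: "t \<in> ?I" for t
  proof -
    obtain G where G: "\<And>x. (G has_vector_derivative u t x) (at x)"
      using continuous_antiderivative[OF sobolevD(1)[OF u3[OF t]]] by blast
    then have G': "(G has_real_derivative u t x) (at x)" for x
      by (simp add: has_real_derivative_iff_has_vector_derivative)
    have cG: "continuous_on A G" for A
      by (rule DERIV_continuous_on[OF has_field_derivative_at_within[OF G']])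
    have int: "integral {0..x} (u t) = G x - G 0" if "x \<ge> 0" for x
      using that by (intro integral_unique fundamental_theorem_of_calculus has_vector_derivative_at_within[OF G])
    have ad: "antideriv (u t) x = G x - integral {0..1} G" if x: "x \<in> {0..1}" for x
    proof -
      have "integral {0..1} (\<lambda>z. integral {0..z} (u t)) = integral {0..1} (\<lambda>z. G z - G 0)"
        by (intro integral_cong int) auto
      also have "\<dots> = integral {0..1} G - G 0"
        by (subst integral_diff) (auto intro!: integrable_continuous_interval cG)
      finally show ?thesis using x by (simp add: antideriv_def int)
    qed
    have per1: "f 1 = f 0" if "periodic f" for f :: "real \<Rightarrow> real"
      using that unfolding periodic_def by (metis add_0)
    \<comment> \<open>The left-hand side of the equation is periodic, so comparing both ends of the
      fundamental domain forces zero mean, as \<gamma> is nonzero.\<close>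
    have "\<gamma> * antideriv (u t) 0 = \<gamma> * antideriv (u t) 1"
      using eq[OF t, of 0] eq[OF t, of 1] per1[OF u_per[OF t]] per1[OF v_per[OF t]] per1[OF w_per[OF t]] by simp
    then have "G 1 = G 0" using \<open>\<gamma> > 0\<close> by (simp add: ad)
    then have perG: "periodic G"
      using antiderivative_increment[OF G u_per[OF t]] int[of 1] by (simp add: periodic_def)
    define P where "P x = G x - integral {0..1} G" for x
    have "v t x = - (u t x * deriv (u t) x) + \<gamma> * P x" for x
    proof -
      \<comment> \<open>The equation is imposed only on [0, 1]; its residual is periodic, so it
        vanishes on the whole line.\<close>
      define r where "r x = v t x + u t x * deriv (u t) x - \<gamma> * P x" for x
      have "periodic r"
        using u_per[OF t] v_per[OF t] w_per[OF t] perG by (simp add: periodic_def r_def P_def)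
      moreover have "r (frac x) = 0"
        using eq[OF t, of "frac x"] ad[of "frac x"] frac_lt_1[of x] frac_ge_0[of x] by (simp add: r_def P_def less_imp_le)
      ultimately have "r x = 0" using periodic_frac[of r x] by simp
      then show ?thesis by (simp add: r_def)
    qed
    moreover have "periodic P" using perG by (simp add: periodic_def P_def)
    moreover have "(P has_real_derivative u t x) (at x)" for x
      unfolding P_def by (auto intro!: derivative_eq_intros G')
    moreover have "\<bar>P x\<bar> \<le> B" if "\<forall>x. \<bar>u t x\<bar> \<le> B" for x B
      unfolding P_def by (rule mean_zero_antiderivative_bound[OF G' perG]) (use that in blast)
    ultimately show ?thesis by blast
  qed
  have "classical_solution \<gamma> T u (\<lambda>t. deriv (u t)) v"
  proof
    fix t x assume t: "t \<in> ?I"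
    have tI: "t \<in> {0..<T}" using t by auto
    show "periodic (u t)" by (rule u_per[OF t])
    show "(u t has_real_derivative deriv (u t) x) (at x)" by (rule sobolev_deriv(1)[OF u3[OF t]])
    show "\<exists>q. (deriv (u t) has_real_derivative q) (at x)"
      using sobolev_deriv(1)[OF sobolev_deriv(2)[OF u3[OF t]]] by blast
    show "((\<lambda>s. u s x) has_real_derivative v t x) (at t)"
      using sobolev_has_derivative_pointwise[OF D tI] at[OF t] by simp
    show "\<exists>P. periodic P \<and> (\<forall>x. (P has_real_derivative u t x) (at x)) \<and>
      (\<forall>x. v t x = - (u t x * deriv (u t) x) + \<gamma> * P x) \<and>
      (\<forall>B. (\<forall>x. \<bar>u t x\<bar> \<le> B) \<longrightarrow> (\<forall>x. \<bar>P x\<bar> \<le> B))" by (rule P[OF t])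
    fix q assume q: "(deriv (u t) has_real_derivative q) (at x)"
    obtain P where P': "\<And>x. (P has_real_derivative u t x) (at x)"
      "\<And>x. v t x = - (u t x * deriv (u t) x) + \<gamma> * P x" using P[OF t] by blast
    \<comment> \<open>Differentiating this identity in x computes the derivative of v from q; by
      interchange of derivatives it is the time derivative of u_x.\<close>
    have "v t = (\<lambda>x. - (u t x * deriv (u t) x) + \<gamma> * P x)" using P'(2) by auto
    then have "(v t has_real_derivative - (deriv (u t) x)\<^sup>2 - u t x * q + \<gamma> * u t x) (at x)"
      by (auto intro!: derivative_eq_intros P' q sobolev_deriv(1)[OF u3[OF t]] simp: power2_eq_square)
    then have "deriv (v t) x = - (deriv (u t) x)\<^sup>2 - u t x * q + \<gamma> * u t x" by (rule DERIV_imp_deriv)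
    then show "((\<lambda>s. deriv (u s) x) has_real_derivative
        - (deriv (u t) x)\<^sup>2 - u t x * q + \<gamma> * u t x) (at t)"
      using sobolev_has_derivative_pointwise[OF sobolev_has_derivative_deriv[OF D] tI, of x] at[OF t] by simp
  next
    show "continuous_on (?I \<times> UNIV) (\<lambda>(t, x). u t x)"
      by (rule sobolev_continuous_joint[OF sobolev_continuous_subset[OF cont3 sub]])
    show "continuous_on (?I \<times> UNIV) (\<lambda>(t, x). deriv (u t) x)"
      by (rule sobolev_continuous_joint[OF sobolev_continuous_deriv[OF sobolev_continuous_subset[OF cont3 sub]]])
    show "continuous_on (?I \<times> UNIV) (\<lambda>(t, x). v t x)"
      by (rule sobolev_continuous_joint[OF sobolev_continuous_subset[OF cont2 sub]])
  qed (use assms in auto)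
  then show ?thesis by (rule that)
qed

theorem theorem4:
  fixes \<gamma> T :: real and u0 :: "real \<Rightarrow> real" and u :: "real \<Rightarrow> real \<Rightarrow> real"
  assumes "\<gamma> > 0"
    and "u0 \<in> sobolev 3"
    and "integral {0..1} u0 = 0"
    and "finite_blow_up_time \<gamma> u0 T u"
  shows "((\<lambda>t. (T - t) * (INF x. deriv (u t) x)) \<longlongrightarrow> - 1) (at_left T) \<and>
         ((\<lambda>t. (T - t) * (SUP x. deriv (u t) x)) \<longlongrightarrow> 0) (at_left T)"
proof -
  have T: "T > 0" and sol: "ostrovsky_hunter_solution \<gamma> u0 T u"
    and blow_up: "filterlim (\<lambda>t. sobolev_norm 3 (u t)) at_top (at_left T)"
    using assms(4) by (auto simp: finite_blow_up_time_def maximal_solution_def)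
  obtain v where "classical_solution \<gamma> T u (\<lambda>t. deriv (u t)) v"
    using ostrovsky_hunter_classical[OF assms(1) T sol] .
  then interpret classical_solution \<gamma> T u "\<lambda>t. deriv (u t)" v .
  have "sobolev_continuous 3 {0..<T} u" using sol by (simp add: ostrovsky_hunter_solution_def)
  then have "sobolev_continuous 3 {0<..<T} u" by (rule sobolev_continuous_subset) auto
  from inf_rate[OF this blow_up] sup_rate show ?thesis by blast
qed

end
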